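(* Let $\alpha>3$, $t_0>0$, $x_0\in\mathcal H$, and let $x:[t_0,+\infty)\to\mathcal H$ be a bounded solution of the Cauchy problem $$\tfrac{\alpha}{t}\dot x(t)+\operatorname{proj}_{C(x(t))+\ddot x(t)}(0)=0\ (t>t_0),\qquad x(t_0)=x_0,\ \dot x(t_0)=0 .$$ Assume that every $f_i$ is bounded from below and that the Assumption on the weak Pareto set in the context holds. Then $x(t)$ converges weakly, as $t\to+\infty$, to a weakly Pareto optimal point of the problem $\min_{x\in\mathcal H}F(x)$.
   Context: $\mathcal H$ is a real Hilbert space. $f_1,\dots,f_m:\mathcal H\to\mathbb R$ are convex and continuously differentiable, and $F=(f_1,\dots,f_m)$. $C(x)=\operatorname{co}\{\nabla f_i(x):i=1,\dots,m\}$. For a closed convex $K\subset\mathcal H$, $\operatorname{proj}_K(y)=\arg\min_{w\in K}\|w-y\|^2$. A solution of the Cauchy problem is a function $x:[t_0,+\infty)\to\mathcal H$ such that: $x\in C^1([t_0,+\infty))$; $\dot x$ is absolutely continuous on $[t_0,T]$ for every $T\ge t_0$; there is a Bochner measurable $\ddot x$ with $\dot x(t)=\dot x(t_0)+\int_{t_0}^t\ddot x(s)\,ds$ for all $t$, and $\frac{d}{dt}\dot x=\ddot x$ a.e.; the equation holds for almost all $t\ge t_0$; and the initial conditions hold. A point $x^*$ is weakly Pareto optimal if there is no $x$ with $f_i(x)<f_i(x^* )$ for all $i$; $P_w$ denotes the set of such points. For $\hat F\in\mathbb R^m$, $\mathcal L(\hat F)=\{x:F(x)\le\hat F\}$ and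 $P_w(\hat F)=P_w\cap\mathcal L(\hat F)$. Assumption: for all $x_0\in\mathcal H$ and all $x\in\mathcal L(F(x_0))$ there exists $x^*\in P_w(F(x))$, and $$R:=\sup_{F^*\in F(P_w(F(x_0)))}\ \inf_{x\in F^{-1}(F^* )}\tfrac12\|x-x_0\|^2<+\infty .$$ *)

theory Defs
  imports "HOL-Analysis.Analysis"
begin

text \<open>Metric projection onto a set K: the minimiser of the distance to y over K
  (well defined and unique when K is nonempty, closed and convex in a Hilbert space).\<close>
definition proj :: "'a::real_inner set \<Rightarrow> 'a \<Rightarrow> 'a" where
  "proj K y = (SOME w. w \<in> K \<and> (\<forall>z\<in>K. (norm (w - y))\<^sup>2 \<le> (norm (z - y))\<^sup>2))"

definition abs_continuous_on :: "real set \<Rightarrow> (real \<Rightarrow> 'a::real_normed_vector) \<Rightarrow> bool" where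
  "abs_continuous_on S g \<longleftrightarrow>
     (\<forall>e>0. \<exists>d>0. \<forall>n::nat. \<forall>a b. (\<forall>k<n. a k \<in> S \<and> b k \<in> S \<and> a k \<le> b k)
        \<and> (\<forall>j<n. \<forall>k<n. j \<noteq> k \<longrightarrow> b j \<le> a k \<or> b k \<le> a j)
        \<and> (\<Sum>k<n. b k - a k) < d
        \<longrightarrow> (\<Sum>k<n. norm (g (b k) - g (a k))) < e)"

definition weakly_tendsto_at_top :: "(real \<Rightarrow> 'a::real_inner) \<Rightarrow> 'a \<Rightarrow> bool" where
  "weakly_tendsto_at_top x y \<longleftrightarrow> (\<forall>v. ((\<lambda>t. inner (x t) v) \<longlongrightarrow> inner y v) at_top)"

definition weakly_pareto :: "nat \<Rightarrow> (nat \<Rightarrow> 'a \<Rightarrow> real) \<Rightarrow> 'a \<Rightarrow> bool" where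
  "weakly_pareto m f xs \<longleftrightarrow> \<not> (\<exists>x. \<forall>i<m. f i x < f i xs)"

definition level :: "nat \<Rightarrow> (nat \<Rightarrow> 'a \<Rightarrow> real) \<Rightarrow> (nat \<Rightarrow> real) \<Rightarrow> 'a set" where
  "level m f Fh = {x. \<forall>i<m. f i x \<le> Fh i}"

definition pareto_level :: "nat \<Rightarrow> (nat \<Rightarrow> 'a \<Rightarrow> real) \<Rightarrow> (nat \<Rightarrow> real) \<Rightarrow> 'a set" where
  "pareto_level m f Fh = {x. weakly_pareto m f x} \<inter> level m f Fh"

end

theory Submission
  imports Defs
begin

text \<open>Along a solution each energy \<open>W_i = f_i(x) + 1/2 \<parallel>x'\<parallel>\<^sup>2\<close> is nonincreasing, with
  \<open>W_i' \<le> -(\<alpha>/t) \<parallel>x'\<parallel>\<^sup>2\<close>: this is the variational inequality of the projection. For a fixed \<open>z\<close> put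
  \<open>gap = min_i (f_i(x) - f_i(z))\<close>, \<open>h = 1/2 \<parallel>x - z\<parallel>\<^sup>2\<close> and \<open>q = t h' + (\<alpha> - 1) h\<close>. Convexity gives
  \<open>q' \<le> t \<parallel>x'\<parallel>\<^sup>2 - t gap\<close>, and then \<open>E = t\<^sup>2 (gap + 1/2 \<parallel>x'\<parallel>\<^sup>2) + 2 q\<close> satisfies
  \<open>E' \<le> -(\<alpha> - 3) t \<parallel>x'\<parallel>\<^sup>2\<close>. Hence \<open>gap \<le> E(t0) / t\<^sup>2\<close> for every \<open>z\<close>, which makes every weak cluster point
  weakly Pareto optimal by weak lower semicontinuity. Every cluster point \<open>z\<close> also satisfies
  \<open>f_i(z) \<le> W_i(t)\<close> for all \<open>i\<close> and \<open>t\<close>; for such \<open>z\<close> one gets \<open>\<integral> t \<parallel>x'\<parallel>\<^sup>2 < \<infinity>\<close>, so \<open>q\<close> is a nonincreasing function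
  plus a convergent one, \<open>q\<close> converges, and therefore \<open>h\<close> converges. Opial's lemma concludes.\<close>

section \<open>Weak compactness and Opial's lemma\<close>

text \<open>The minimiser of \<open>J v = (norm v)^2 / 2 - \<phi> v\<close> represents
  \<open>\<phi>\<close>: the parallelogram identity makes minimising sequences Cauchy, and the
  first-order condition at their limit is \<open>\<phi> = inner z\<close>.\<close>

lemma Riesz_representation:
  fixes \<phi> :: "'a::{real_inner, complete_space} \<Rightarrow> real"
  assumes "bounded_linear \<phi>"
  obtains z where "\<And>v. \<phi> v = inner z v"
proof -
  interpret bounded_linear \<phi> by fact
  obtain M where M: "\<And>v. \<bar>\<phi> v\<bar> \<le> norm v * M" using bounded by auto
  define J where "J v = (norm v)\<^sup>2 / 2 - \<phi> v" for v
  have J_ge: "- M\<^sup>2 / 2 \<le> J v" for v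
  proof -
    have "0 \<le> (norm v - M)\<^sup>2" by simp
    then show ?thesis using M[of v] by (simp add: J_def power2_eq_square algebra_simps)
  qed
  then have bdd: "bdd_below (range J)" by (intro bdd_belowI) auto
  define l where "l = Inf (range J)"
  have l_le: "l \<le> J v" for v unfolding l_def using bdd by (intro cINF_lower) auto
  have "\<exists>v. J v < l + 1 / Suc n" for n
    using cInf_lessD[of "range J" "l + 1 / Suc n"] by (auto simp: l_def)
  then obtain u where u: "\<And>n. J (u n) < l + 1 / Suc n" by metis
  have par: "(norm (a - b))\<^sup>2 \<le> 4 * (J a - l) + 4 * (J b - l)" for a b
  proof -
    have "(norm (a - b))\<^sup>2 = 4 * J a + 4 * J b - 8 * J ((1/2) *\<^sub>R (a + b))"
      by (simp add: J_def scaleR add power2_norm_eq_inner inner_simps inner_commute field_simps)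
    then show ?thesis using l_le[of "(1/2) *\<^sub>R (a + b)"] by simp
  qed
  have "Cauchy u"
  proof (rule metric_CauchyI)
    fix e :: real assume "e > 0"
    then obtain N where N: "1 / Suc N < e\<^sup>2 / 8" using nat_approx_posE[of "e\<^sup>2/8"] by (metis divide_pos_pos zero_less_numeral zero_less_power)
    have "dist (u a) (u b) < e" if "a \<ge> N" "b \<ge> N" for a b
    proof -
      have "J (u k) - l < e\<^sup>2 / 8" if "k \<ge> N" for k
      proof -
        have "1 / Suc k \<le> 1 / Suc N" using that by (simp add: field_simps)
        then show ?thesis using u[of k] N by simp
      qed
      from this[OF that(1)] this[OF that(2)] have "(norm (u a - u b))\<^sup>2 < e\<^sup>2"
        using par[of "u a" "u b"] by simp
      then show ?thesis using \<open>e > 0\<close> by (simp add: dist_norm power2_less_imp_less)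
    qed
    then show "\<exists>M. \<forall>m\<ge>M. \<forall>n\<ge>M. dist (u m) (u n) < e" by blast
  qed
  then obtain z where z: "u \<longlonglongrightarrow> z" using Cauchy_convergent convergent_def by blast
  have "(\<lambda>n. J (u n)) \<longlonglongrightarrow> J z" unfolding J_def by (intro tendsto_intros z tendsto) simp
  moreover have "(\<lambda>n. l + 1 / Suc n) \<longlonglongrightarrow> l + 0"
    by (intro tendsto_intros LIMSEQ_inverse_real_of_nat[unfolded inverse_eq_divide])
  ultimately have "J z \<le> l + 0" by (rule LIMSEQ_le) (use u less_imp_le in blast)
  then have Jz: "J z \<le> l" by simp
  have "\<phi> v = inner z v" for v
  proof -
    let ?d = "inner z v - \<phi> v"
    have ineq: "0 \<le> s * ?d + s\<^sup>2 * (norm v)\<^sup>2 / 2" for s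
    proof -
      have "(norm (z + s *\<^sub>R v))\<^sup>2 = (norm z)\<^sup>2 + 2 * s * inner z v + s\<^sup>2 * (norm v)\<^sup>2"
        unfolding power2_norm_eq_inner
        by (simp add: inner_simps inner_commute algebra_simps power2_eq_square)
      then have "J (z + s *\<^sub>R v) = J z + s * ?d + s\<^sup>2 * (norm v)\<^sup>2 / 2"
        by (simp add: J_def add scaleR field_simps)
      then show ?thesis using Jz l_le[of "z + s *\<^sub>R v"] by simp
    qed
    have "?d = 0"
    proof (cases "v = 0")
      case False
      then have "norm v > 0" by simp
      \<comment> \<open>This value of \<open>s\<close> minimises the quadratic in
        \<open>ineq\<close>.\<close>
      then have "- ?d / (norm v)\<^sup>2 * ?d + (- ?d / (norm v)\<^sup>2)\<^sup>2 * (norm v)\<^sup>2 / 2 = - (?d\<^sup>2) / (2 * (norm v)\<^sup>2)"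
        by (simp add: field_simps power2_eq_square)
      then have "0 \<le> - (?d\<^sup>2) / (2 * (norm v)\<^sup>2)" using ineq[of "- ?d / (norm v)\<^sup>2"] by simp
      then have "?d\<^sup>2 \<le> 0" using \<open>norm v > 0\<close> by (simp add: field_simps)
      then show ?thesis by simp
    qed (simp add: zero)
    then show ?thesis by simp
  qed
  then show thesis using that by blast
qed

text \<open>Weak sequential compactness is replaced by compactness along filters, which follows from
  Tychonoff's theorem without any separability argument.\<close>

lemma bounded_imp_weak_cluster_point:
  fixes x :: "'t \<Rightarrow> 'a::{real_inner, complete_space}"
  assumes "F \<noteq> bot" and bound: "eventually (\<lambda>t. norm (x t) \<le> M) F"
  obtains G z where "G \<le> F" "G \<noteq> bot" "\<And>v. ((\<lambda>t. inner (x t) v) \<longlongrightarrow> inner z v) G"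
proof -
  define X where "X t = inner (x t)" for t
  define U where "U = (\<Pi>\<^sub>E v\<in>(UNIV :: 'a set). {- (M * norm v)..M * norm v})"
  have "compact U"
    using compactin_PiE[of "\<lambda>_. euclideanreal" UNIV "\<lambda>v::'a. {- (M * norm v)..M * norm v}"]
    by (simp add: U_def euclidean_product_topology)
  moreover have "filtermap X F \<noteq> bot" using assms by (simp add: filtermap_bot_iff)
  moreover have "eventually (\<lambda>p. p \<in> U) (filtermap X F)"
    unfolding eventually_filtermap
  proof (rule eventually_mono[OF bound])
    fix t assume "norm (x t) \<le> M"
    then have "\<bar>inner (x t) v\<bar> \<le> M * norm v" for v
      using Cauchy_Schwarz_ineq2[of "x t" v] by (meson mult_right_mono norm_ge_zero order_trans)
    then show "X t \<in> U" by (auto simp: U_def X_def abs_le_iff minus_le_iff)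
  qed
  ultimately obtain \<phi> where \<phi>: "\<phi> \<in> U" "inf (nhds \<phi>) (filtermap X F) \<noteq> bot"
    unfolding compact_filter by blast
  \<comment> \<open>\<open>G\<close> keeps the times whose functional is close to
    \<open>\<phi>\<close>; it is proper because \<open>\<phi>\<close> is a cluster point of the
    image filter.\<close>
  define G where "G = inf F (filtercomap X (nhds \<phi>))"
  have "G \<le> F" by (simp add: G_def)
  have "G \<noteq> bot"
  proof
    assume "G = bot"
    then obtain P Q where PQ: "eventually P F" "eventually Q (filtercomap X (nhds \<phi>))"
        "\<And>t. P t \<and> Q t \<Longrightarrow> False"
      using eventually_False[of G] unfolding G_def eventually_inf by auto
    then obtain R where R: "eventually R (nhds \<phi>)" "\<And>t. R (X t) \<Longrightarrow> Q t"
      unfolding eventually_filtercomap by auto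
    have "eventually (\<lambda>p. \<not> R p) (filtermap X F)"
      unfolding eventually_filtermap by (rule eventually_mono[OF PQ(1)]) (use PQ(3) R(2) in blast)
    then have "eventually (\<lambda>_. False) (inf (nhds \<phi>) (filtermap X F))"
      unfolding eventually_inf using R by blast
    then show False using \<phi>(2) by (simp add: trivial_limit_def)
  qed
  have "filterlim X (nhds \<phi>) G"
    unfolding G_def by (rule filterlim_mono[OF filterlim_filtercomap]) auto
  then have "((\<lambda>t. X t v) \<longlongrightarrow> \<phi> v) G" for v
    by (rule continuous_on_tendsto_compose[OF continuous_on_product_coordinates]) auto
  then have lim: "((\<lambda>t. inner (x t) v) \<longlongrightarrow> \<phi> v) G" for v by (simp add: X_def)
  have "bounded_linear \<phi>"
  proof (rule bounded_linear_intro)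
    show "\<phi> (a + b) = \<phi> a + \<phi> b" for a b
      using tendsto_unique[OF \<open>G \<noteq> bot\<close> lim[of "a + b"]] tendsto_add[OF lim[of a] lim[of b]]
      by (simp add: inner_add_right)
    show "\<phi> (r *\<^sub>R a) = r *\<^sub>R \<phi> a" for r a
      using tendsto_unique[OF \<open>G \<noteq> bot\<close> lim[of "r *\<^sub>R a"]] tendsto_mult[OF tendsto_const lim[of a]]
      by simp
    show "norm (\<phi> a) \<le> norm a * M" for a
      using \<phi>(1) by (auto simp: U_def PiE_iff abs_le_iff minus_le_iff mult.commute)
  qed
  then obtain z where z: "\<And>v. \<phi> v = inner z v" by (rule Riesz_representation) metis
  show thesis by (rule that[OF \<open>G \<le> F\<close> \<open>G \<noteq> bot\<close> lim[unfolded z]])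
qed

text \<open>The difference of the squared distances to two cluster points is affine in
  \<open>x t\<close>, so \<open>inner (x t) (z' - z)\<close> converges along \<open>at_top\<close>;
  computing the limit along both filters forces \<open>z' = z\<close>. Boundedness and a unique weak
  cluster point then give weak convergence.\<close>

lemma Opial:
  fixes x :: "real \<Rightarrow> 'a::{real_inner, complete_space}"
  assumes bound: "eventually (\<lambda>t. norm (x t) \<le> M) at_top"
    and conv: "\<And>z. z \<in> S \<Longrightarrow> \<exists>l. ((\<lambda>t. (norm (x t - z))\<^sup>2) \<longlongrightarrow> l) at_top"
    and cluster: "\<And>G z. G \<le> at_top \<Longrightarrow> G \<noteq> bot \<Longrightarrow>
      (\<And>v. ((\<lambda>t. inner (x t) v) \<longlongrightarrow> inner z v) G) \<Longrightarrow> z \<in> S"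
  shows "\<exists>z\<in>S. weakly_tendsto_at_top x z"
proof -
  obtain G z where G: "G \<le> at_top" "G \<noteq> bot" "\<And>v. ((\<lambda>t. inner (x t) v) \<longlongrightarrow> inner z v) G"
    using bounded_imp_weak_cluster_point[OF trivial_limit_at_top_linorder bound] by blast
  have z: "z \<in> S" using cluster G by blast
  have unique: "z' = z" if G': "G' \<le> at_top" "G' \<noteq> bot"
    "\<And>v. ((\<lambda>t. inner (x t) v) \<longlongrightarrow> inner z' v) G'" for G' z'
  proof -
    have "z' \<in> S" using cluster G' by blast
    then obtain l l' where "((\<lambda>t. (norm (x t - z))\<^sup>2) \<longlongrightarrow> l) at_top" "((\<lambda>t. (norm (x t - z'))\<^sup>2) \<longlongrightarrow> l') at_top"
      using conv z by meson
    then have "((\<lambda>t. ((norm (x t - z))\<^sup>2 - (norm (x t - z'))\<^sup>2 - (norm z)\<^sup>2 + (norm z')\<^sup>2) / 2)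
        \<longlongrightarrow> (l - l' - (norm z)\<^sup>2 + (norm z')\<^sup>2) / 2) at_top"
      by (intro tendsto_intros) auto
    moreover have "((norm (x t - z))\<^sup>2 - (norm (x t - z'))\<^sup>2 - (norm z)\<^sup>2 + (norm z')\<^sup>2) / 2
        = inner (x t) (z' - z)" for t
      by (simp add: power2_norm_eq_inner inner_simps inner_commute field_simps)
    ultimately obtain L where "((\<lambda>t. inner (x t) (z' - z)) \<longlongrightarrow> L) at_top" by auto
    then have "inner z (z' - z) = L" "inner z' (z' - z) = L"
      using G G' tendsto_mono tendsto_unique by meson+
    then have "inner (z' - z) (z' - z) = 0" by (simp add: inner_diff_left)
    then show ?thesis by simp
  qed
  have "((\<lambda>t. inner (x t) v) \<longlongrightarrow> inner z v) at_top" for v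
  proof (rule topological_tendstoI, rule ccontr)
    fix V assume V: "open V" "inner z v \<in> V" "\<not> (\<forall>\<^sub>F t in at_top. inner (x t) v \<in> V)"
    \<comment> \<open>Restricting to the times that miss \<open>V\<close> leaves a proper filter,
      whose weak cluster points must again equal \<open>z\<close>.\<close>
    define F where "F = inf at_top (principal {t. inner (x t) v \<notin> V})"
    have "F \<noteq> bot" using V(3) unfolding F_def trivial_limit_def eventually_inf_principal by simp
    moreover have "F \<le> at_top" by (simp add: F_def)
    ultimately obtain G' z' where G': "G' \<le> F" "G' \<noteq> bot" "\<And>v. ((\<lambda>t. inner (x t) v) \<longlongrightarrow> inner z' v) G'"
      by (rule bounded_imp_weak_cluster_point[OF _ filter_leD[OF _ bound]]) metis
    then have "z' = z" using unique \<open>F \<le> at_top\<close> by (meson order_trans)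
    then have "\<forall>\<^sub>F t in G'. inner (x t) v \<in> V" using G'(3) V by (auto simp: tendsto_def)
    moreover have "\<forall>\<^sub>F t in G'. inner (x t) v \<notin> V"
      by (rule filter_leD[OF G'(1)]) (auto simp: F_def eventually_inf_principal)
    ultimately have "\<forall>\<^sub>F t in G'. False" by eventually_elim simp
    then show False using G'(2) by simp
  qed
  then show ?thesis using z unfolding weakly_tendsto_at_top_def by blast
qed

section \<open>Absolutely continuous functions\<close>

lemma abs_continuous_onE:
  assumes "abs_continuous_on S g" "e > 0"
  obtains d where "d > 0" "\<And>(n::nat) a b. \<forall>k<n. a k \<in> S \<and> b k \<in> S \<and> a k \<le> b k \<Longrightarrow>
       \<forall>j<n. \<forall>k<n. j \<noteq> k \<longrightarrow> b j \<le> a k \<or> b k \<le> a j \<Longrightarrow> (\<Sum>k<n. b k - a k) < d \<Longrightarrow>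
       (\<Sum>k<n. norm (g (b k) - g (a k))) < e"
proof -
  obtain d where "d > 0" and d: "\<forall>n::nat. \<forall>a b. (\<forall>k<n. a k \<in> S \<and> b k \<in> S \<and> a k \<le> b k)
        \<and> (\<forall>j<n. \<forall>k<n. j \<noteq> k \<longrightarrow> b j \<le> a k \<or> b k \<le> a j) \<and> (\<Sum>k<n. b k - a k) < d
        \<longrightarrow> (\<Sum>k<n. norm (g (b k) - g (a k))) < e"
    using assms(1)[unfolded abs_continuous_on_def, THEN spec, THEN mp, OF assms(2)] by (elim exE conjE)
  then show thesis by (intro that[OF \<open>d > 0\<close>] d[THEN spec, THEN spec, THEN spec, THEN mp] conjI)
qed

text \<open>Sums, inner products, multiples and C1 functions are all reduced to this one domination
  criterion.\<close>

lemma abs_continuous_on_dominated: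
  assumes p: "abs_continuous_on S p" and r: "abs_continuous_on S r"
    and dom: "\<And>u v. u \<in> S \<Longrightarrow> v \<in> S \<Longrightarrow>
      norm (g v - g u) \<le> L * (norm (p v - p u) + norm (r v - r u))"
  shows "abs_continuous_on S g"
  unfolding abs_continuous_on_def
proof (intro allI impI)
  fix e :: real assume "e > 0"
  \<comment> \<open>\<open>L\<close> may be zero or negative; a positive upper bound permits the
    division and keeps the inequality strict.\<close>
  define L' where "L' = \<bar>L\<bar> + 1"
  have L': "L' > 0" "L \<le> L'" by (auto simp: L'_def)
  define e' where "e' = e / (2 * L')"
  have "e' > 0" using \<open>e > 0\<close> L' by (simp add: e'_def)
  obtain d1 where d1: "d1 > 0" "\<And>(n::nat) a b. (\<forall>k<n. a k \<in> S \<and> b k \<in> S \<and> a k \<le> b k) \<Longrightarrow>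
       (\<forall>j<n. \<forall>k<n. j \<noteq> k \<longrightarrow> b j \<le> a k \<or> b k \<le> a j) \<Longrightarrow> (\<Sum>k<n. b k - a k) < d1 \<Longrightarrow>
       (\<Sum>k<n. norm (p (b k) - p (a k))) < e'"
    using abs_continuous_onE[OF p \<open>e' > 0\<close>] by blast
  obtain d2 where d2: "d2 > 0" "\<And>(n::nat) a b. (\<forall>k<n. a k \<in> S \<and> b k \<in> S \<and> a k \<le> b k) \<Longrightarrow>
       (\<forall>j<n. \<forall>k<n. j \<noteq> k \<longrightarrow> b j \<le> a k \<or> b k \<le> a j) \<Longrightarrow> (\<Sum>k<n. b k - a k) < d2 \<Longrightarrow>
       (\<Sum>k<n. norm (r (b k) - r (a k))) < e'"
    using abs_continuous_onE[OF r \<open>e' > 0\<close>] by blast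
  show "\<exists>d>0. \<forall>(n::nat) a b. (\<forall>k<n. a k \<in> S \<and> b k \<in> S \<and> a k \<le> b k)
        \<and> (\<forall>j<n. \<forall>k<n. j \<noteq> k \<longrightarrow> b j \<le> a k \<or> b k \<le> a j) \<and> (\<Sum>k<n. b k - a k) < d
        \<longrightarrow> (\<Sum>k<n. norm (g (b k) - g (a k))) < e"
  proof (intro exI conjI allI impI; (elim conjE)?)
    show "min d1 d2 > 0" using d1 d2 by simp
    fix n :: nat and a b
    assume A: "\<forall>k<n. a k \<in> S \<and> b k \<in> S \<and> a k \<le> b k"
      and B: "\<forall>j<n. \<forall>k<n. j \<noteq> k \<longrightarrow> b j \<le> a k \<or> b k \<le> a j"
      and C: "(\<Sum>k<n. b k - a k) < min d1 d2"
    have "(\<Sum>k<n. norm (g (b k) - g (a k)))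
        \<le> (\<Sum>k<n. L' * (norm (p (b k) - p (a k)) + norm (r (b k) - r (a k))))"
    proof (rule sum_mono)
      fix k assume "k \<in> {..<n}"
      then have "norm (g (b k) - g (a k)) \<le> L * (norm (p (b k) - p (a k)) + norm (r (b k) - r (a k)))"
        using A dom by blast
      also have "\<dots> \<le> L' * (norm (p (b k) - p (a k)) + norm (r (b k) - r (a k)))"
        using L' by (intro mult_right_mono) auto
      finally show "norm (g (b k) - g (a k)) \<le> L' * (norm (p (b k) - p (a k)) + norm (r (b k) - r (a k)))" .
    qed
    also have "\<dots> = L' * ((\<Sum>k<n. norm (p (b k) - p (a k))) + (\<Sum>k<n. norm (r (b k) - r (a k))))"
      by (simp add: sum_distrib_left sum.distrib algebra_simps)
    also have "\<dots> < L' * (e' + e')"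
      using d1(2)[OF A B] d2(2)[OF A B] C L' by (intro mult_strict_left_mono add_strict_mono) auto
    also have "\<dots> = e" using L' by (simp add: e'_def field_simps)
    finally show "(\<Sum>k<n. norm (g (b k) - g (a k))) < e" .
  qed
qed

lemma abs_continuous_on_ident: "abs_continuous_on S (\<lambda>t::real. t)"
  unfolding abs_continuous_on_def
proof (intro allI impI)
  fix e :: real assume "e > 0"
  have "(\<Sum>k<n. norm (b k - a k)) < e"
    if "\<forall>k<n. a k \<in> S \<and> b k \<in> S \<and> a k \<le> b k" "(\<Sum>k<n. b k - a k) < e" for n :: nat and a b :: "nat \<Rightarrow> real"
  proof -
    have "(\<Sum>k<n. norm (b k - a k)) = (\<Sum>k<n. b k - a k)" using that by (intro sum.cong) auto
    then show ?thesis using that by simp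
  qed
  then show "\<exists>d>0. \<forall>(n::nat) a b. (\<forall>k<n. a k \<in> S \<and> b k \<in> S \<and> a k \<le> b k)
        \<and> (\<forall>j<n. \<forall>k<n. j \<noteq> k \<longrightarrow> b j \<le> a k \<or> b k \<le> a j) \<and> (\<Sum>k<n. b k - a k) < d
        \<longrightarrow> (\<Sum>k<n. norm (b k - a k)) < e"
    using \<open>e > 0\<close> by blast
qed

lemma abs_continuous_on_add:
  assumes "abs_continuous_on S p" "abs_continuous_on S r"
  shows "abs_continuous_on S (\<lambda>t. p t + r t)"
  using assms
proof (rule abs_continuous_on_dominated)
  fix u v
  have "p v + r v - (p u + r u) = (p v - p u) + (r v - r u)" by simp
  then show "norm (p v + r v - (p u + r u)) \<le> 1 * (norm (p v - p u) + norm (r v - r u))"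
    by (metis mult_1 norm_triangle_ineq)
qed

lemma abs_continuous_on_inner:
  fixes p r :: "real \<Rightarrow> 'a::real_inner"
  assumes "abs_continuous_on S p" "abs_continuous_on S r" "bounded (p ` S)" "bounded (r ` S)"
  shows "abs_continuous_on S (\<lambda>t. inner (p t) (r t))"
proof -
  obtain M1 M2 where M: "\<And>t. t \<in> S \<Longrightarrow> norm (p t) \<le> M1" "\<And>t. t \<in> S \<Longrightarrow> norm (r t) \<le> M2"
    using assms(3,4) unfolding bounded_iff by auto
  show ?thesis
    using assms(1,2)
  proof (rule abs_continuous_on_dominated)
    fix u v assume uv: "u \<in> S" "v \<in> S"
    have "inner (p v) (r v) - inner (p u) (r u) = inner (p v) (r v - r u) + inner (p v - p u) (r u)"
      by (simp add: inner_simps)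
    then have "norm (inner (p v) (r v) - inner (p u) (r u))
        \<le> norm (p v) * norm (r v - r u) + norm (p v - p u) * norm (r u)"
      by (metis Cauchy_Schwarz_ineq2 add_mono norm_triangle_le real_norm_def)
    also have "\<dots> \<le> max M1 M2 * norm (r v - r u) + norm (p v - p u) * max M1 M2"
      using M uv by (intro add_mono mult_left_mono mult_right_mono) (auto intro: le_max_iff_disj[THEN iffD2])
    finally show "norm (inner (p v) (r v) - inner (p u) (r u))
        \<le> max M1 M2 * (norm (p v - p u) + norm (r v - r u))"
      by (simp add: algebra_simps)
  qed
qed

text \<open>The derivative is bounded on the compact interval, so the mean value inequality makes
  \<open>p\<close> Lipschitz, that is, dominated by the identity.\<close>

lemma C1_imp_abs_continuous_on:
  fixes p :: "real \<Rightarrow> 'a::real_normed_vector"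
  assumes der: "\<And>t. t \<in> {a..b} \<Longrightarrow> (p has_vector_derivative p' t) (at t within {a..b})"
    and cont: "continuous_on {a..b} p'"
  shows "abs_continuous_on {a..b} p"
proof -
  obtain M where M: "\<And>t. t \<in> {a..b} \<Longrightarrow> norm (p' t) \<le> M"
    using compact_imp_bounded[OF compact_continuous_image[OF cont]] unfolding bounded_iff by (auto simp del: atLeastAtMost_iff)
  have "norm (p v - p u) \<le> M * norm (v - u)" if "u \<in> {a..b}" "v \<in> {a..b}" for u v
  proof (rule differentiable_bound[where f' = "\<lambda>t h. h *\<^sub>R p' t"])
    show "onorm (\<lambda>h. h *\<^sub>R p' t) \<le> M" if "t \<in> {a..b}" for t
      by (rule onorm_le) (use M[OF that] in \<open>simp add: mult.commute[of M] mult_left_mono\<close>)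
  qed (use der that in \<open>auto simp: has_vector_derivative_def\<close>)
  moreover have "0 \<le> M" if "u \<in> {a..b}" for u using M[OF that] norm_ge_zero order_trans by blast
  ultimately have "norm (p v - p u) \<le> M * (norm (v - u) + norm (v - u))" if "u \<in> {a..b}" "v \<in> {a..b}" for u v
    using that by (smt (verit) mult_left_mono norm_ge_zero)
  then show ?thesis
    by (intro abs_continuous_on_dominated[OF abs_continuous_on_ident abs_continuous_on_ident, where L = M]) auto
qed

lemma abs_continuous_on_subset:
  assumes "abs_continuous_on T g" "S \<subseteq> T"
  shows "abs_continuous_on S g"
  unfolding abs_continuous_on_def
proof (intro allI impI)
  fix e :: real assume "e > 0"
  from abs_continuous_onE[OF assms(1) this] obtain d where "d > 0"
    and d: "\<And>(n::nat) a b. \<forall>k<n. a k \<in> T \<and> b k \<in> T \<and> a k \<le> b k \<Longrightarrow>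
       \<forall>j<n. \<forall>k<n. j \<noteq> k \<longrightarrow> b j \<le> a k \<or> b k \<le> a j \<Longrightarrow> (\<Sum>k<n. b k - a k) < d \<Longrightarrow>
       (\<Sum>k<n. norm (g (b k) - g (a k))) < e" by blast
  show "\<exists>d>0. \<forall>(n::nat) a b. (\<forall>k<n. a k \<in> S \<and> b k \<in> S \<and> a k \<le> b k)
        \<and> (\<forall>j<n. \<forall>k<n. j \<noteq> k \<longrightarrow> b j \<le> a k \<or> b k \<le> a j) \<and> (\<Sum>k<n. b k - a k) < d
        \<longrightarrow> (\<Sum>k<n. norm (g (b k) - g (a k))) < e"
    using assms(2) by (intro exI[of _ d] conjI \<open>d > 0\<close> allI impI d) (auto simp: subset_iff)
qed

lemma abs_continuous_on_cmult:
  fixes p :: "real \<Rightarrow> real"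
  assumes "abs_continuous_on S p"
  shows "abs_continuous_on S (\<lambda>t. c * p t)"
  by (rule abs_continuous_on_dominated[OF assms assms, where L = "\<bar>c\<bar>"])
    (simp add: right_diff_distrib[symmetric] abs_mult mult_left_mono)

text \<open>Cousin's lemma gives a tagged division that is fine for a gauge controlling difference quotients at the
  points of differentiability; the remaining tags lie in an open set of small measure, on which absolute
  continuity controls the increments.\<close>

lemma abs_continuous_on_nonincreasing:
  fixes g :: "real \<Rightarrow> real"
  assumes ab: "a \<le> b" and ac: "abs_continuous_on {a..b} g"
    and ae: "AE t in lborel. a < t \<and> t < b \<longrightarrow> (\<exists>D\<le>0. (g has_real_derivative D) (at t))"
  shows "g b \<le> g a"
proof -
  obtain N0 where N0: "N0 \<in> null_sets lborel"
      "\<And>t. t \<in> {a<..<b} - N0 \<Longrightarrow> \<exists>D\<le>0. (g has_real_derivative D) (at t)"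
    using ae unfolding eventually_ae_filter by fastforce
  define T where "T = {a<..<b} - N0"
  \<comment> \<open>The endpoints can be tags although no derivative is assumed there, so they join
    the null set that \<open>U\<close> will cover.\<close>
  define N where "N = N0 \<union> {a, b}"
  have "{a, b} \<in> null_sets lborel" by (intro finite_imp_null_set_lborel) auto
  then have "N \<in> null_sets lborel" using N0(1) unfolding N_def by (intro null_sets.Un)
  then have N: "N \<in> null_sets lebesgue" by (rule null_sets_completionI)
  \<comment> \<open>Tags of differentiability contribute \<open>e * (b - a)\<close>, all other tags
    contribute \<open>e\<close>.\<close>
  have eps: "g b - g a \<le> e * (b - a) + e" if "e > 0" for e
  proof -
    obtain d where d: "d > 0" "\<And>(n::nat) u v. (\<forall>k<n. u k \<in> {a..b} \<and> v k \<in> {a..b} \<and> u k \<le> v k) \<Longrightarrow>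
        (\<forall>j<n. \<forall>k<n. j \<noteq> k \<longrightarrow> v j \<le> u k \<or> v k \<le> u j) \<Longrightarrow> (\<Sum>k<n. v k - u k) < d \<Longrightarrow>
        (\<Sum>k<n. norm (g (v k) - g (u k))) < e"
      using abs_continuous_onE[OF ac \<open>e > 0\<close>] by blast
    obtain U where U: "open U" "N \<subseteq> U" "emeasure lebesgue (U - N) < ennreal d"
      using sets_lebesgue_outer_open[OF _ d(1), of N] N by blast
    have "emeasure lebesgue (U - N) = emeasure lebesgue U"
      using N U(1) by (intro emeasure_Diff_null_set) auto
    then have Ud: "emeasure lborel U < ennreal d" using U by simp
    \<comment> \<open>Straddle estimate: the tag lies between \<open>u\<close> and \<open>v\<close>,
      so the errors on the two sides, of size \<open>v - t\<close> and \<open>t - u\<close>, add up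
      to a multiple of \<open>v - u\<close>.\<close>
    have "\<exists>\<delta>>0. \<forall>u v. t - \<delta> < u \<and> u \<le> t \<and> t \<le> v \<and> v < t + \<delta> \<longrightarrow> g v - g u \<le> e * (v - u)"
      if t: "t \<in> T" for t
    proof -
      obtain D where D: "D \<le> 0" "(g has_real_derivative D) (at t)" using N0(2) t by (auto simp: T_def)
      then obtain \<delta> where \<delta>: "\<delta> > 0" "\<And>y. norm (y - t) < \<delta> \<Longrightarrow> norm (g y - g t - D * (y - t)) \<le> e * norm (y - t)"
        using \<open>e > 0\<close> unfolding has_field_derivative_def has_derivative_at_alt by meson
      have "g v - g u \<le> e * (v - u)" if "t - \<delta> < u" "u \<le> t" "t \<le> v" "v < t + \<delta>" for u v
      proof -
        have "D * (v - t) \<le> 0" "0 \<le> D * (u - t)"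
          using D that by (auto simp: mult_nonpos_nonneg mult_nonpos_nonpos)
        moreover have "\<bar>g v - g t - D * (v - t)\<bar> \<le> e * (v - t)" "\<bar>g u - g t - D * (u - t)\<bar> \<le> e * (t - u)"
          using \<delta>(2)[of v] \<delta>(2)[of u] that by auto
        ultimately show ?thesis by (simp add: algebra_simps abs_le_iff)
      qed
      then show ?thesis using \<delta>(1) by blast
    qed
    then obtain \<delta> where \<delta>: "\<And>t. t \<in> T \<Longrightarrow> \<delta> t > 0"
      "\<And>t u v. t \<in> T \<Longrightarrow> t - \<delta> t < u \<Longrightarrow> u \<le> t \<Longrightarrow> t \<le> v \<Longrightarrow> v < t + \<delta> t \<Longrightarrow> g v - g u \<le> e * (v - u)"
      by metis
    \<comment> \<open>A tag in \<open>{a..b}\<close> outside \<open>T\<close> forces its interval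
      into \<open>U\<close>; the value \<open>UNIV\<close> off \<open>{a..b}\<close> makes
      \<open>\<gamma>\<close> a gauge on the whole line.\<close>
    define \<gamma> where "\<gamma> t = (if t \<in> T then ball t (\<delta> t) else if t \<in> {a..b} then U else UNIV)" for t
    have "t \<in> U" if "t \<in> {a..b}" "t \<notin> T" for t using that U(2) by (auto simp: T_def N_def)
    then have "gauge \<gamma>" using \<delta>(1) U(1) by (auto simp: gauge_def \<gamma>_def)
    then obtain P where P: "P tagged_division_of {a..b}" "\<gamma> fine P" by (rule fine_division_exists_real)
    have PK: "\<exists>u v. K = {u..v} \<and> u \<le> t \<and> t \<le> v \<and> a \<le> u \<and> v \<le> b \<and> Inf K = u \<and> Sup K = v"
      if tK: "(t, K) \<in> P" for t K
    proof -
      obtain u v where "K = {u..v}" using tagged_division_ofD(4)[OF P(1) tK] by auto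
      then show ?thesis using tagged_division_ofD(2,3)[OF P(1) tK] by force
    qed
    \<comment> \<open>Degenerate intervals are left out: their increments vanish, and one lying
      inside another interval would violate the non-overlap condition of absolute
      continuity.\<close>
    define Q where "Q = {y \<in> P. fst y \<notin> T \<and> Inf (snd y) < Sup (snd y)}"
    have "finite P" using P(1) by blast
    then have "finite Q" by (simp add: Q_def)
    then obtain h where h: "bij_betw h {0..<card Q} Q" using ex_bij_betw_nat_finite by blast
    define u where "u k = Inf (snd (h k))" for k
    define v where "v k = Sup (snd (h k))" for k
    let ?n = "card Q"
    have hQ: "h k \<in> Q" if "k < ?n" for k using h that by (auto simp: bij_betw_def)
    have hK: "snd (h k) = {u k..v k} \<and> u k < v k \<and> a \<le> u k \<and> v k \<le> b \<and> {u k..v k} \<subseteq> U" if "k < ?n" for k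
    proof -
      obtain t K where tK: "h k = (t, K)" by fastforce
      then have "(t, K) \<in> P" "t \<notin> T" "Inf K < Sup K" using hQ[OF that] by (auto simp: Q_def)
      moreover from this(1) obtain u' v' where "K = {u'..v'}" "u' \<le> t" "t \<le> v'" "a \<le> u'" "v' \<le> b" "Inf K = u'" "Sup K = v'"
        using PK by blast
      moreover have "K \<subseteq> \<gamma> t" using P(2) \<open>(t, K) \<in> P\<close> unfolding fine_def by blast
      ultimately show ?thesis by (auto simp: u_def v_def tK \<gamma>_def)
    qed
    have disj: "v j \<le> u k \<or> v k \<le> u j" if "j < ?n" "k < ?n" "j \<noteq> k" for j k
    proof (rule ccontr)
      assume "\<not> ?thesis"
      then have "max (u j) (u k) < min (v j) (v k)" using hK that by auto
      then obtain c where "max (u j) (u k) < c" "c < min (v j) (v k)" using dense by blast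
      then have "c \<in> interior (snd (h j)) \<inter> interior (snd (h k))" using hK that by simp
      moreover have "h j \<noteq> h k" using h that by (auto simp: bij_betw_def inj_on_def)
      moreover have "h j \<in> P" "h k \<in> P" using hQ that by (auto simp: Q_def)
      ultimately show False using tagged_division_ofD(5)[OF P(1)] by (metis empty_iff prod.collapse)
    qed
    have "(\<Sum>k<?n. v k - u k) < d"
    proof -
      have "disjoint_family_on (\<lambda>k. {u k<..<v k}) {..<?n}"
        unfolding disjoint_family_on_def using disj by fastforce
      then have "(\<Sum>k<?n. emeasure lborel {u k<..<v k}) = emeasure lborel (\<Union>k<?n. {u k<..<v k})"
        by (intro sum_emeasure) auto
      also have "\<dots> \<le> emeasure lborel U" using hK U(1) by (intro emeasure_mono) (auto, fastforce)
      also have "\<dots> < ennreal d" by (rule Ud)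
      also have "(\<Sum>k<?n. emeasure lborel {u k<..<v k}) = (\<Sum>k<?n. ennreal (v k - u k))"
        using hK by (intro sum.cong) (auto simp: less_imp_le)
      also have "\<dots> = ennreal (\<Sum>k<?n. v k - u k)" using hK by (intro sum_ennreal) (auto simp: less_imp_le)
      finally show ?thesis by (meson ennreal_leI not_less)
    qed
    then have small: "(\<Sum>k<?n. norm (g (v k) - g (u k))) < e"
      using hK disj by (intro d(2)) (auto simp: less_imp_le, (meson less_imp_le order_trans)+)
    let ?I = "\<lambda>y. g (Sup (snd y)) - g (Inf (snd y))"
    have "(\<Sum>k<?n. norm (g (v k) - g (u k))) = (\<Sum>y\<in>Q. \<bar>?I y\<bar>)"
      unfolding u_def v_def using sum.reindex_bij_betw[OF h, of "\<lambda>y. \<bar>?I y\<bar>"] by (simp add: atLeast0LessThan)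
    also have "\<dots> = (\<Sum>y\<in>P. if fst y \<notin> T \<and> Inf (snd y) < Sup (snd y) then \<bar>?I y\<bar> else 0)"
      unfolding Q_def by (rule sum.inter_filter[OF \<open>finite P\<close>])
    finally have Qsum: "(\<Sum>y\<in>P. if fst y \<notin> T \<and> Inf (snd y) < Sup (snd y) then \<bar>?I y\<bar> else 0) < e"
      using small by simp
    have "g b - g a = (\<Sum>y\<in>P. ?I y)"
      using additive_tagged_division_1[OF ab P(1), of g] by (simp add: case_prod_beta)
    also have "\<dots> \<le> (\<Sum>y\<in>P. e * (Sup (snd y) - Inf (snd y))
        + (if fst y \<notin> T \<and> Inf (snd y) < Sup (snd y) then \<bar>?I y\<bar> else 0))"
    proof (rule sum_mono)
      fix y assume "y \<in> P"
      obtain t K where tK: "y = (t, K)" by fastforce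
      then obtain u' v' where K: "K = {u'..v'}" "u' \<le> t" "t \<le> v'" "Inf K = u'" "Sup K = v'"
        using PK \<open>y \<in> P\<close> by blast
      show "?I y \<le> e * (Sup (snd y) - Inf (snd y))
        + (if fst y \<notin> T \<and> Inf (snd y) < Sup (snd y) then \<bar>?I y\<bar> else 0)"
      proof (cases "t \<in> T")
        case True
        have "K \<subseteq> \<gamma> t" using P(2) \<open>y \<in> P\<close> tK unfolding fine_def by blast
        then have sub: "{u'..v'} \<subseteq> ball t (\<delta> t)" using True K by (simp add: \<gamma>_def)
        then have "u' \<in> ball t (\<delta> t)" "v' \<in> ball t (\<delta> t)"
          using subsetD[OF sub, of u'] subsetD[OF sub, of v'] K by auto
        then have "g v' - g u' \<le> e * (v' - u')" using K True by (intro \<delta>(2)[of t]) (auto simp: dist_real_def)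
        then show ?thesis using True K tK by simp
      next
        case False
        have "0 \<le> e * (v' - u')" using K \<open>e > 0\<close> by simp
        then show ?thesis using False K tK by (cases "u' = v'") auto
      qed
    qed
    also have "\<dots> = e * (\<Sum>y\<in>P. Sup (snd y) - Inf (snd y))
        + (\<Sum>y\<in>P. if fst y \<notin> T \<and> Inf (snd y) < Sup (snd y) then \<bar>?I y\<bar> else 0)"
      by (simp add: sum.distrib sum_distrib_left)
    also have "(\<Sum>y\<in>P. Sup (snd y) - Inf (snd y)) = b - a"
      using additive_tagged_division_1[OF ab P(1), of "\<lambda>t. t"] by (simp add: case_prod_beta)
    finally show ?thesis using Qsum by simp
  qed
  show ?thesis
  proof (rule field_le_epsilon)
    fix e :: real assume "e > 0"
    \<comment> \<open>The bound in \<open>eps\<close> is \<open>e * (b - a + 1)\<close>, whence this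
      rescaling.\<close>
    then have "e / (b - a + 1) > 0" using ab by simp
    from eps[OF this] have "g b - g a \<le> e / (b - a + 1) * (b - a + 1)" by (simp add: distrib_left)
    then show "g b \<le> g a + e" using ab by simp
  qed
qed

section \<open>Projections, convex functions and limits at infinity\<close>

text \<open>Compactness, available for the hull of finitely many gradients, makes the distance
  attain its minimum, so the choice in \<open>proj\<close> is a genuine minimiser. The inequality is
  the obtuse-angle property of closest points.\<close>

lemma proj_variational:
  fixes K :: "'a::real_inner set"
  assumes "compact K" "convex K" "K \<noteq> {}"
  shows "proj K y \<in> K" "\<And>c. c \<in> K \<Longrightarrow> inner (y - proj K y) (c - proj K y) \<le> 0"
proof -
  have "\<exists>w\<in>K. \<forall>z\<in>K. (norm (w - y))\<^sup>2 \<le> (norm (z - y))\<^sup>2"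
    using assms by (intro continuous_attains_inf continuous_intros)
  then have "\<exists>w. w \<in> K \<and> (\<forall>z\<in>K. (norm (w - y))\<^sup>2 \<le> (norm (z - y))\<^sup>2)" by blast
  from someI_ex[OF this] have "proj K y \<in> K \<and> (\<forall>z\<in>K. (norm (proj K y - y))\<^sup>2 \<le> (norm (z - y))\<^sup>2)"
    unfolding proj_def .
  then have w: "proj K y \<in> K" "\<And>z. z \<in> K \<Longrightarrow> dist y (proj K y) \<le> dist y z"
    by (auto simp: dist_norm norm_minus_commute)
  then show "proj K y \<in> K" by simp
  show "inner (y - proj K y) (c - proj K y) \<le> 0" if "c \<in> K" for c
    using assms w that by (intro any_closest_point_dot[of K]) (auto intro: compact_imp_closed)
qed

text \<open>Restriction to the line through \<open>z\<close> and \<open>y\<close> reduces this to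
  the tangent inequality in one variable.\<close>

lemma convex_on_above_tangent_inner:
  fixes f :: "'a::real_inner \<Rightarrow> real"
  assumes "convex_on UNIV f" "(f has_derivative (\<lambda>h. inner g h)) (at z)"
  shows "f z + inner g (y - z) \<le> f y"
proof -
  define \<phi> where "\<phi> s = f (z + s *\<^sub>R (y - z))" for s
  have "convex_on UNIV \<phi>"
  proof (rule convex_onI)
    fix t a b :: real assume t: "0 < t" "t < 1"
    have "z + ((1 - t) *\<^sub>R a + t *\<^sub>R b) *\<^sub>R (y - z)
        = (1 - t) *\<^sub>R (z + a *\<^sub>R (y - z)) + t *\<^sub>R (z + b *\<^sub>R (y - z))"
      by (simp add: algebra_simps)
    then show "\<phi> ((1 - t) *\<^sub>R a + t *\<^sub>R b) \<le> (1 - t) * \<phi> a + t * \<phi> b"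
      using convex_onD[OF assms(1), of t] t by (simp add: \<phi>_def)
  qed simp
  moreover have "(\<phi> has_real_derivative inner g (y - z)) (at 0)"
  proof -
    have "((\<lambda>s. z + s *\<^sub>R (y - z)) has_derivative (\<lambda>s. s *\<^sub>R (y - z))) (at 0)"
      by (auto intro!: derivative_eq_intros)
    from has_derivative_compose[OF this, of f "inner g"] show ?thesis
      using assms(2) by (simp add: \<phi>_def[abs_def] has_field_derivative_def mult_commute_abs)
  qed
  ultimately have "\<phi> 1 - \<phi> 0 \<ge> inner g (y - z) * (1 - 0)"
    by (intro convex_on_imp_above_tangent[where A = UNIV]) auto
  then show ?thesis by (simp add: \<phi>_def)
qed

lemma continuous_on_Min_image:
  fixes g :: "'i \<Rightarrow> 'a::topological_space \<Rightarrow> real"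
  assumes "finite I" "I \<noteq> {}" "\<And>i. i \<in> I \<Longrightarrow> continuous_on S (g i)"
  shows "continuous_on S (\<lambda>t. Min ((\<lambda>i. g i t) ` I))"
  using assms
proof (induction I rule: finite_ne_induct)
  case (insert i I)
  then have "(\<lambda>t. Min ((\<lambda>i. g i t) ` insert i I)) = (\<lambda>t. min (g i t) (Min ((\<lambda>i. g i t) ` I)))" by auto
  then show ?case using insert by (auto intro!: continuous_on_min)
qed simp

lemma antimono_bounded_imp_tendsto_at_top:
  fixes g :: "real \<Rightarrow> real"
  assumes anti: "\<And>s t. a \<le> s \<Longrightarrow> s \<le> t \<Longrightarrow> g t \<le> g s" and below: "\<And>t. a \<le> t \<Longrightarrow> c \<le> g t"
  shows "\<exists>l. (g \<longlongrightarrow> l) at_top"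
proof -
  have bdd: "bdd_below (g ` {a..})" using below by (intro bdd_belowI2) auto
  have "(g \<longlongrightarrow> Inf (g ` {a..})) at_top"
  proof (rule decreasing_tendsto)
    show "\<forall>\<^sub>F t in at_top. Inf (g ` {a..}) \<le> g t"
      using eventually_ge_at_top[of a] by eventually_elim (auto intro: cINF_lower[OF bdd])
    fix y assume "Inf (g ` {a..}) < y"
    then obtain s where s: "a \<le> s" "g s < y" using cInf_lessD[of "g ` {a..}" y] by auto
    show "\<forall>\<^sub>F t in at_top. g t < y"
      using eventually_ge_at_top[of s] by eventually_elim (use anti s in fastforce)
  qed
  then show ?thesis by blast
qed

text \<open>Dividing the last hypothesis by \<open>t\<close> makes \<open>h t + c * ln t\<close>
  nonincreasing, so \<open>h\<close> would tend to minus infinity.\<close>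

lemma logarithmic_decrease_contradiction:
  fixes h h' :: "real \<Rightarrow> real"
  assumes "s > 0" "c > 0"
    and der: "\<And>t. t \<ge> s \<Longrightarrow> (h has_real_derivative h' t) (at t)"
    and nonneg: "\<And>t. t \<ge> s \<Longrightarrow> 0 \<le> h t" and le: "\<And>t. t \<ge> s \<Longrightarrow> t * h' t \<le> - c"
  shows False
proof -
  have bound: "h t + c * ln t \<le> h s + c * ln s" if "t \<ge> s" for t
  proof (rule DERIV_nonpos_imp_nonincreasing[OF that, of "\<lambda>t. h t + c * ln t"])
    fix \<tau> assume \<tau>: "s \<le> \<tau>" "\<tau> \<le> t"
    have "((\<lambda>t. h t + c * ln t) has_real_derivative h' \<tau> + c * (1 / \<tau>)) (at \<tau>)"
      using \<tau> assms(1) by (auto intro!: derivative_eq_intros der)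
    moreover have "h' \<tau> + c * (1 / \<tau>) \<le> 0" using le[of \<tau>] \<tau> assms(1) by (simp add: field_simps)
    ultimately show "\<exists>y. ((\<lambda>t. h t + c * ln t) has_real_derivative y) (at \<tau>) \<and> y \<le> 0" by blast
  qed
  have "\<forall>\<^sub>F t in at_top. ln t > (h s + c * ln s) / c"
    using ln_at_top filterlim_at_top_dense by blast
  then have "\<forall>\<^sub>F t in at_top. t \<ge> s \<and> ln t > (h s + c * ln s) / c"
    using eventually_ge_at_top eventually_conj by blast
  then obtain t where "t \<ge> s" "ln t > (h s + c * ln s) / c"
    using eventually_happens[of _ "at_top :: real filter"] by auto
  then show False using bound[of t] nonneg[of t] \<open>c > 0\<close> by (simp add: field_simps)
qed

text \<open>With the integrating factor \<open>t powr c\<close>, the quotient of the derivatives of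
  \<open>t powr c * h t\<close> and \<open>t powr c\<close> is
  \<open>(t * h' t + c * h t) / c\<close>. L'Hospital's rule asks only the denominator to
  diverge.\<close>

lemma tendsto_of_euler_operator:
  fixes h h' :: "real \<Rightarrow> real"
  assumes "c > 0" and der: "\<And>t. t > a \<Longrightarrow> (h has_real_derivative h' t) (at t)"
    and lim: "((\<lambda>t. t * h' t + c * h t) \<longlongrightarrow> L) at_top"
  shows "(h \<longlongrightarrow> L / c) at_top"
proof -
  have pos: "\<forall>\<^sub>F t in at_top. t > max a 0" by (rule eventually_gt_at_top)
  have "((\<lambda>t. (t powr c * h t) / (t powr c)) \<longlongrightarrow> L / c) at_top"
  proof (rule lhospital_at_top_at_top)
    have exp: "filterlim (\<lambda>t::real. exp (c * ln t)) at_top at_top"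
      by (rule filterlim_compose[OF exp_at_top
            filterlim_tendsto_pos_mult_at_top[OF tendsto_const assms(1) ln_at_top]])
    have eq: "\<forall>\<^sub>F t in at_top. exp (c * ln t) = t powr c"
      using pos by eventually_elim (auto simp: powr_def)
    show "filterlim (\<lambda>t. t powr c) at_top at_top"
      by (rule iffD1[OF filterlim_cong[OF refl refl eq] exp])
    show "\<forall>\<^sub>F t in at_top. c * t powr (c - 1) \<noteq> 0" using pos by eventually_elim (use assms(1) in auto)
    show "\<forall>\<^sub>F t in at_top. ((\<lambda>t. t powr c) has_real_derivative c * t powr (c - 1)) (at t)"
      using pos by eventually_elim (auto intro!: derivative_eq_intros)
    show "\<forall>\<^sub>F t in at_top. ((\<lambda>t. t powr c * h t) has_real_derivative
        c * t powr (c - 1) * h t + h' t * t powr c) (at t)"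
      using pos by eventually_elim (auto intro!: derivative_eq_intros der)
    have "((\<lambda>t. (t * h' t + c * h t) / c) \<longlongrightarrow> L / c) at_top"
      by (intro tendsto_intros lim) (use assms(1) in auto)
    moreover have "\<forall>\<^sub>F t in at_top. (t * h' t + c * h t) / c
        = (c * t powr (c - 1) * h t + h' t * t powr c) / (c * t powr (c - 1))"
      using pos
    proof eventually_elim
      case (elim t)
      then have "t powr c = t * t powr (c - 1)" using powr_mult_base[of t "c - 1"] by simp
      then show ?case using elim assms(1) by (simp add: field_simps)
    qed
    ultimately show "((\<lambda>t. (c * t powr (c - 1) * h t + h' t * t powr c) / (c * t powr (c - 1))) \<longlongrightarrow> L / c) at_top"
      by (rule Lim_transform_eventually)
  qed
  moreover have "\<forall>\<^sub>F t in at_top. (t powr c * h t) / (t powr c) = h t" using pos by eventually_elim auto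
  ultimately show ?thesis by (rule Lim_transform_eventually)
qed

lemma continuous_imp_integral_has_real_derivative:
  fixes k :: "real \<Rightarrow> real"
  assumes "continuous_on {a..} k" "t > a"
  shows "((\<lambda>u. integral {a..u} k) has_real_derivative k t) (at t)"
proof -
  have "((\<lambda>u. integral {a..u} k) has_real_derivative k t) (at t within {a..t + 1})"
    using assms by (intro integral_has_real_derivative) (auto intro: continuous_on_subset)
  moreover have "at t within {a..t + 1} = at t" using assms(2) by (intro at_within_interior) auto
  ultimately show ?thesis by simp
qed

lemma continuous_imp_continuous_on_integral:
  fixes k :: "real \<Rightarrow> real"
  assumes "continuous_on {a..} k" "a \<le> s"
  shows "continuous_on {s..t} (\<lambda>u. integral {a..u} k)"
proof -
  have "continuous_on {a..t} (\<lambda>u. integral {a..u} k)"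
    using assms by (intro indefinite_integral_continuous_1 integrable_continuous_real)
      (auto intro: continuous_on_subset)
  then show ?thesis using assms(2) by (auto intro: continuous_on_subset)
qed

section \<open>The inertial multiobjective flow\<close>

locale multiobjective_inertial_flow =
  fixes m :: nat
    and f :: "nat \<Rightarrow> 'a::{real_inner, complete_space} \<Rightarrow> real"
    and gf :: "nat \<Rightarrow> 'a \<Rightarrow> 'a"
    and \<alpha> t0 :: real
    and x xd xdd :: "real \<Rightarrow> 'a"
  assumes m_pos: "m > 0"
    and f_convex: "\<And>i. i < m \<Longrightarrow> convex_on UNIV (f i)"
    and grad: "\<And>i z. i < m \<Longrightarrow> (f i has_derivative (\<lambda>h. inner (gf i z) h)) (at z)"
    and grad_cont: "\<And>i. i < m \<Longrightarrow> continuous_on UNIV (gf i)"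
    and alpha: "\<alpha> > 3" and t0: "t0 > 0"
    and x_deriv: "\<And>t. t \<ge> t0 \<Longrightarrow> (x has_vector_derivative xd t) (at t within {t0..})"
    and xd_cont: "continuous_on {t0..} xd"
    and xd_ac: "\<And>T. T \<ge> t0 \<Longrightarrow> abs_continuous_on {t0..T} xd"
    and xdd_deriv: "AE t in lborel. t > t0 \<longrightarrow> (xd has_vector_derivative xdd t) (at t)"
    and ode: "AE t in lborel. t > t0 \<longrightarrow>
       (\<alpha> / t) *\<^sub>R xd t
       + proj ((\<lambda>c. c + xdd t) ` (convex hull ((\<lambda>i. gf i (x t)) ` {..<m}))) 0 = 0"
begin

section \<open>Quantities along the flow and their regularity\<close>

definition energy :: "nat \<Rightarrow> real \<Rightarrow> real" where
  "energy i t = f i (x t) + (norm (xd t))\<^sup>2 / 2"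

text \<open>The minimum over the objectives takes the place of \<open>f (x t) - f z\<close> for a
  single objective.\<close>

definition gap :: "'a \<Rightarrow> real \<Rightarrow> real" where
  "gap z t = Min ((\<lambda>i. f i (x t) - f i z) ` {..<m})"

definition anchor :: "'a \<Rightarrow> real \<Rightarrow> real" where
  "anchor z t = (norm (x t - z))\<^sup>2 / 2"

text \<open>The Euler operator \<open>t * h' + (\<alpha> - 1) * h\<close> applied to
  \<open>h = anchor z\<close>. With the weight \<open>\<alpha> - 1\<close> its derivative is
  \<open>t * h'' + \<alpha> * h'\<close>, in which the friction term of the equation
  cancels.\<close>

definition euler_anchor :: "'a \<Rightarrow> real \<Rightarrow> real" where
  "euler_anchor z t = t * inner (x t - z) (xd t) + (\<alpha> - 1) * anchor z t"

definition dissipation :: "real \<Rightarrow> real" where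
  "dissipation t = integral {t0..t} (\<lambda>s. s * (norm (xd s))\<^sup>2)"

lemma gap_le: "i < m \<Longrightarrow> gap z t \<le> f i (x t) - f i z"
  unfolding gap_def by (intro Min_le) auto

lemma gap_attained: "\<exists>i<m. gap z t = f i (x t) - f i z"
proof -
  have "gap z t \<in> (\<lambda>i. f i (x t) - f i z) ` {..<m}"
    unfolding gap_def using m_pos by (intro Min_in) auto
  then show ?thesis by auto
qed

lemma x_cont: "continuous_on {t0..} x"
  using x_deriv by (auto intro!: has_vector_derivative_continuous continuous_at_imp_continuous_on
      simp: continuous_on_eq_continuous_within)

lemma f_cont: "i < m \<Longrightarrow> continuous_on UNIV (f i)"
  using grad by (auto intro!: has_derivative_continuous continuous_at_imp_continuous_on)

lemma fx_cont: "i < m \<Longrightarrow> continuous_on {t0..} (\<lambda>t. f i (x t))"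
  using continuous_on_compose2[OF f_cont x_cont] by simp

lemma gap_cont: "continuous_on {t0..} (gap z)"
  unfolding gap_def[abs_def] using m_pos
  by (intro continuous_on_Min_image continuous_intros fx_cont) auto

lemma x_deriv_at: "t > t0 \<Longrightarrow> (x has_vector_derivative xd t) (at t)"
  using x_deriv[of t] at_within_interior[of t "{t0..}"] by simp

lemma fx_deriv:
  assumes "i < m" "(x has_vector_derivative xd t) (at t within S)"
  shows "((\<lambda>t. f i (x t)) has_real_derivative inner (gf i (x t)) (xd t)) (at t within S)"
  using has_derivative_compose[OF assms(2)[unfolded has_vector_derivative_def] grad[OF assms(1), of "x t"]]
  by (simp add: has_field_derivative_def mult_commute_abs)

lemma anchor_deriv:
  assumes "(x has_vector_derivative xd t) (at t within S)"
  shows "(anchor z has_real_derivative inner (x t - z) (xd t)) (at t within S)"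
proof -
  have "((\<lambda>t. inner (x t - z) (x t - z) / 2) has_derivative
      (\<lambda>h. (inner (x t - z) (h *\<^sub>R xd t) + inner (h *\<^sub>R xd t) (x t - z)) / 2)) (at t within S)"
    using assms[unfolded has_vector_derivative_def] by (auto intro!: derivative_eq_intros)
  then show ?thesis
    by (simp add: anchor_def[abs_def] power2_norm_eq_inner has_field_derivative_def inner_commute mult_commute_abs)
qed

lemma x_deriv_within: "t0 \<le> s \<Longrightarrow> \<tau> \<in> {s..t} \<Longrightarrow> (x has_vector_derivative xd \<tau>) (at \<tau> within {s..t})"
  using x_deriv[of \<tau>] by (auto intro: has_vector_derivative_within_subset)

lemma xd_cont_on: "t0 \<le> s \<Longrightarrow> continuous_on {s..t} xd"
  using xd_cont by (auto intro: continuous_on_subset)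

lemma x_cont_on: "t0 \<le> s \<Longrightarrow> continuous_on {s..t} x"
  using x_cont by (auto intro: continuous_on_subset)

lemma xd_ac_on: "t0 \<le> s \<Longrightarrow> s \<le> t \<Longrightarrow> abs_continuous_on {s..t} xd"
  using abs_continuous_on_subset[OF xd_ac[of t], of "{s..t}"] by auto

lemma real_C1_ac:
  fixes p p' :: "real \<Rightarrow> real"
  assumes "\<And>\<tau>. \<tau> \<in> {s..t} \<Longrightarrow> (p has_real_derivative p' \<tau>) (at \<tau> within {s..t})" "continuous_on {s..t} p'"
  shows "abs_continuous_on {s..t} p"
  using C1_imp_abs_continuous_on[of s t p p'] assms by (simp add: has_real_derivative_iff_has_vector_derivative)

lemma integral_ac:
  fixes k :: "real \<Rightarrow> real"
  assumes "continuous_on {t0..} k" "t0 \<le> s"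
  shows "abs_continuous_on {s..t} (\<lambda>u. integral {t0..u} k)"
proof (rule real_C1_ac)
  show "continuous_on {s..t} k" using assms by (auto intro: continuous_on_subset)
  fix \<tau> assume "\<tau> \<in> {s..t}"
  then have "((\<lambda>u. integral {t0..u} k) has_real_derivative k \<tau>) (at \<tau> within {t0..t})"
    using assms by (intro integral_has_real_derivative) (auto intro: continuous_on_subset)
  then show "((\<lambda>u. integral {t0..u} k) has_real_derivative k \<tau>) (at \<tau> within {s..t})"
    using assms by (auto intro: DERIV_subset)
qed

section \<open>The differential inclusion and the decrease of the energies\<close>

text \<open>The equation identifies the projection as
  \<open>- ((\<alpha> / t) *\<^sub>R xd t)\<close>. Its membership in the translated hull gives the
  formula for \<open>xdd t\<close>; the variational inequality tested at
  \<open>gf i (x t) + xdd t\<close> and divided by \<open>\<alpha> / t\<close> gives the last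
  clause.\<close>

lemma inclusion:
  "AE t in lborel. t > t0 \<longrightarrow> (xd has_vector_derivative xdd t) (at t)
     \<and> (\<exists>g\<in>convex hull ((\<lambda>i. gf i (x t)) ` {..<m}). xdd t = - ((\<alpha> / t) *\<^sub>R xd t) - g)
     \<and> (\<forall>i<m. inner (gf i (x t)) (xd t) + inner (xd t) (xdd t) \<le> - (\<alpha> / t * (norm (xd t))\<^sup>2))"
  using xdd_deriv ode
proof eventually_elim
  case (elim t)
  show ?case
  proof (intro impI conjI)
    assume t: "t > t0"
    then show "(xd has_vector_derivative xdd t) (at t)" using elim by simp
    define C where "C = convex hull ((\<lambda>i. gf i (x t)) ` {..<m})"
    let ?K = "(\<lambda>c. c + xdd t) ` C"
    have C: "compact C" "convex C" "C \<noteq> {}"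
      using m_pos by (auto simp: C_def intro: finite_imp_compact_convex_hull)
    have "compact ?K" using C(1) by (intro compact_continuous_image continuous_intros)
    moreover have "convex ?K" using convex_translation[OF C(2), of "xdd t"] by (simp add: add.commute)
    moreover have "?K \<noteq> {}" using C(3) by simp
    ultimately have K: "proj ?K 0 \<in> ?K" "\<And>c. c \<in> ?K \<Longrightarrow> inner (0 - proj ?K 0) (c - proj ?K 0) \<le> 0"
      by (rule proj_variational)+
    have P: "proj ?K 0 = - ((\<alpha> / t) *\<^sub>R xd t)" using elim t by (simp add: C_def eq_neg_iff_add_eq_0 add.commute)
    have pos: "\<alpha> / t > 0" using alpha t t0 by simp
    obtain g where "g \<in> C" "- ((\<alpha> / t) *\<^sub>R xd t) = g + xdd t" using K(1) unfolding P by blast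
    then show "\<exists>g\<in>convex hull ((\<lambda>i. gf i (x t)) ` {..<m}). xdd t = - ((\<alpha> / t) *\<^sub>R xd t) - g"
      unfolding C_def by (intro bexI[of _ g]) (auto simp: algebra_simps)
    show "\<forall>i<m. inner (gf i (x t)) (xd t) + inner (xd t) (xdd t) \<le> - (\<alpha> / t * (norm (xd t))\<^sup>2)"
    proof (intro allI impI)
      fix i assume "i < m"
      then have "gf i (x t) + xdd t \<in> ?K" unfolding C_def by (auto intro!: imageI hull_inc)
      from K(2)[OF this] have "\<alpha> / t * inner (xd t) (gf i (x t) + xdd t + (\<alpha> / t) *\<^sub>R xd t) \<le> 0"
        unfolding P by simp
      then have "inner (xd t) (gf i (x t) + xdd t + (\<alpha> / t) *\<^sub>R xd t) \<le> 0"
        using pos by (simp only: mult_le_0_iff) linarith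
      then show "inner (gf i (x t)) (xd t) + inner (xd t) (xdd t) \<le> - (\<alpha> / t * (norm (xd t))\<^sup>2)"
        by (simp add: inner_simps power2_norm_eq_inner inner_commute)
    qed
  qed
qed

lemma friction_cont: "continuous_on {t0..} (\<lambda>s. \<alpha> / s * (norm (xd s))\<^sup>2)"
  using t0 by (intro continuous_intros xd_cont) auto

text \<open>The last clause of \<open>inclusion\<close> bounds the derivative of the energy by minus
  the friction integrand. As \<open>xdd\<close> is a derivative only almost everywhere, monotonicity
  comes from absolute continuity.\<close>

lemma energy_decrease:
  assumes "i < m" "t0 \<le> s" "s \<le> t"
  shows "energy i t + integral {t0..t} (\<lambda>s. \<alpha> / s * (norm (xd s))\<^sup>2)
       \<le> energy i s + integral {t0..s} (\<lambda>s. \<alpha> / s * (norm (xd s))\<^sup>2)"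
    (is "energy i t + ?A t \<le> energy i s + ?A s")
proof (rule abs_continuous_on_nonincreasing[OF assms(3), of "\<lambda>t. energy i t + ?A t"])
  have eq: "energy i = (\<lambda>\<tau>. f i (x \<tau>) + 1/2 * inner (xd \<tau>) (xd \<tau>))"
    by (simp add: energy_def fun_eq_iff power2_norm_eq_inner)
  have bd: "bounded (xd ` {s..t})"
    using xd_cont_on[OF assms(2)] by (intro compact_imp_bounded compact_continuous_image) auto
  have "abs_continuous_on {s..t} (\<lambda>\<tau>. f i (x \<tau>))"
  proof (rule real_C1_ac[OF fx_deriv[OF assms(1) x_deriv_within[OF assms(2)]]])
    show "continuous_on {s..t} (\<lambda>\<tau>. inner (gf i (x \<tau>)) (xd \<tau>))"
      using continuous_on_compose2[OF grad_cont[OF assms(1)] x_cont_on[OF assms(2), of t]]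
      by (intro continuous_intros xd_cont_on assms) auto
  qed
  then show "abs_continuous_on {s..t} (\<lambda>t. energy i t + ?A t)"
    unfolding eq
    by (intro abs_continuous_on_add abs_continuous_on_cmult abs_continuous_on_inner xd_ac_on bd
        integral_ac[OF friction_cont] assms)
  show "AE \<tau> in lborel. s < \<tau> \<and> \<tau> < t \<longrightarrow>
      (\<exists>D\<le>0. ((\<lambda>t. energy i t + ?A t) has_real_derivative D) (at \<tau>))"
    using inclusion
  proof eventually_elim
    case (elim \<tau>)
    show ?case
    proof
      assume \<tau>: "s < \<tau> \<and> \<tau> < t"
      then have "\<tau> > t0" using assms by simp
      with elim have xdd: "(xd has_vector_derivative xdd \<tau>) (at \<tau>)"
        and le: "inner (gf i (x \<tau>)) (xd \<tau>) + inner (xd \<tau>) (xdd \<tau>) \<le> - (\<alpha> / \<tau> * (norm (xd \<tau>))\<^sup>2)"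
        using assms(1) by auto
      have "((\<lambda>\<tau>. inner (xd \<tau>) (xd \<tau>)) has_derivative
          (\<lambda>h. inner (xd \<tau>) (h *\<^sub>R xdd \<tau>) + inner (h *\<^sub>R xdd \<tau>) (xd \<tau>))) (at \<tau>)"
        using xdd[unfolded has_vector_derivative_def] by (auto intro!: derivative_eq_intros)
      then have "((\<lambda>\<tau>. inner (xd \<tau>) (xd \<tau>)) has_real_derivative 2 * inner (xd \<tau>) (xdd \<tau>)) (at \<tau>)"
        unfolding has_field_derivative_def
        by (rule has_derivative_eq_rhs) (auto simp: fun_eq_iff inner_commute)
      note kinetic = DERIV_cmult[OF this, of "1/2"]
      note sum = DERIV_add[OF DERIV_add[OF fx_deriv[OF assms(1) x_deriv_at[OF \<open>\<tau> > t0\<close>]] kinetic]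
          continuous_imp_integral_has_real_derivative[OF friction_cont \<open>\<tau> > t0\<close>]]
      have "((\<lambda>t. energy i t + ?A t) has_real_derivative
          inner (gf i (x \<tau>)) (xd \<tau>) + inner (xd \<tau>) (xdd \<tau>) + \<alpha> / \<tau> * (norm (xd \<tau>))\<^sup>2) (at \<tau>)"
        unfolding eq by (rule DERIV_cong[OF sum]) simp
      then show "\<exists>D\<le>0. ((\<lambda>t. energy i t + ?A t) has_real_derivative D) (at \<tau>)"
        using le by (intro exI[of _ "inner (gf i (x \<tau>)) (xd \<tau>) + inner (xd \<tau>) (xdd \<tau>) + \<alpha> / \<tau> * (norm (xd \<tau>))\<^sup>2"]) auto
    qed
  qed
qed

lemma energy_antimono:
  assumes "i < m" "t0 \<le> s" "s \<le> t"
  shows "energy i t \<le> energy i s"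
proof -
  have int: "(\<lambda>s. \<alpha> / s * (norm (xd s))\<^sup>2) integrable_on {t0..t}" for t
    using friction_cont by (intro integrable_continuous_real) (auto intro: continuous_on_subset)
  have "integral {t0..s} (\<lambda>s. \<alpha> / s * (norm (xd s))\<^sup>2) \<le> integral {t0..t} (\<lambda>s. \<alpha> / s * (norm (xd s))\<^sup>2)"
    using assms t0 alpha by (intro integral_subset_le int) auto
  then show ?thesis using energy_decrease[OF assms] by simp
qed

text \<open>By convexity of the objectives each gradient lies in the half-space
  \<open>inner (x t - z) c \<ge> gap z t\<close>, which is convex and so contains the hull. The
  element supplied by \<open>inclusion\<close> needs no further description.\<close>

lemma gap_le_inner_hull:
  assumes "g \<in> convex hull ((\<lambda>i. gf i (x t)) ` {..<m})"
  shows "gap z t \<le> inner g (x t - z)"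
proof -
  have "(\<lambda>i. gf i (x t)) ` {..<m} \<subseteq> {c. inner (x t - z) c \<ge> gap z t}"
  proof safe
    fix i assume "i < m"
    then show "gap z t \<le> inner (x t - z) (gf i (x t))"
      using convex_on_above_tangent_inner[OF f_convex grad, of i "x t" z] gap_le[of i z t]
      by (simp add: inner_simps inner_commute)
  qed
  then have "convex hull ((\<lambda>i. gf i (x t)) ` {..<m}) \<subseteq> {c. inner (x t - z) c \<ge> gap z t}"
    by (rule hull_minimal) (rule convex_halfspace_ge)
  then show ?thesis using assms by (auto simp: inner_commute)
qed

lemma drift_cont: "continuous_on {t0..} (\<lambda>s. s * (norm (xd s))\<^sup>2 - s * gap z s)"
  by (intro continuous_intros xd_cont gap_cont)

lemma euler_anchor_decrease:
  assumes "t0 \<le> s" "s \<le> t"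
  shows "euler_anchor z t - integral {t0..t} (\<lambda>s. s * (norm (xd s))\<^sup>2 - s * gap z s)
       \<le> euler_anchor z s - integral {t0..s} (\<lambda>s. s * (norm (xd s))\<^sup>2 - s * gap z s)"
    (is "_ t - ?B t \<le> _ s - ?B s")
proof (rule abs_continuous_on_nonincreasing[OF assms(2), of "\<lambda>t. euler_anchor z t - ?B t"])
  have eq: "(\<lambda>t. euler_anchor z t - ?B t)
      = (\<lambda>\<tau>. inner (\<tau> *\<^sub>R (x \<tau> - z)) (xd \<tau>) + (\<alpha> - 1) * anchor z \<tau> + (-1) * ?B \<tau>)"
    by (simp add: euler_anchor_def fun_eq_iff)
  have cont: "continuous_on {s..t} (\<lambda>\<tau>. \<tau> *\<^sub>R (x \<tau> - z))"
    by (intro continuous_intros x_cont_on assms)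
  have bd: "bounded ((\<lambda>\<tau>. \<tau> *\<^sub>R (x \<tau> - z)) ` {s..t})" "bounded (xd ` {s..t})"
    using cont xd_cont_on[OF assms(1)] by (auto intro!: compact_imp_bounded compact_continuous_image)
  have ac1: "abs_continuous_on {s..t} (\<lambda>\<tau>. \<tau> *\<^sub>R (x \<tau> - z))"
  proof (rule C1_imp_abs_continuous_on)
    show "((\<lambda>\<tau>. \<tau> *\<^sub>R (x \<tau> - z)) has_vector_derivative \<tau> *\<^sub>R xd \<tau> + (x \<tau> - z)) (at \<tau> within {s..t})"
      if "\<tau> \<in> {s..t}" for \<tau>
      using x_deriv_within[OF assms(1) that] by (auto intro!: derivative_eq_intros)
    show "continuous_on {s..t} (\<lambda>\<tau>. \<tau> *\<^sub>R xd \<tau> + (x \<tau> - z))"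
      by (intro continuous_intros x_cont_on xd_cont_on assms)
  qed
  have ac2: "abs_continuous_on {s..t} (anchor z)"
    by (rule real_C1_ac[OF anchor_deriv[OF x_deriv_within[OF assms(1)]]])
      (auto intro!: continuous_intros x_cont_on xd_cont_on assms)
  show "abs_continuous_on {s..t} (\<lambda>t. euler_anchor z t - ?B t)"
    unfolding eq
    by (intro abs_continuous_on_add abs_continuous_on_cmult abs_continuous_on_inner xd_ac_on bd
        integral_ac[OF drift_cont] ac1 ac2 assms)
  show "AE \<tau> in lborel. s < \<tau> \<and> \<tau> < t \<longrightarrow>
      (\<exists>D\<le>0. ((\<lambda>t. euler_anchor z t - ?B t) has_real_derivative D) (at \<tau>))"
    using inclusion
  proof eventually_elim
    case (elim \<tau>)
    show ?case
    proof
      assume \<tau>: "s < \<tau> \<and> \<tau> < t"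
      then have \<tau>0: "\<tau> > t0" using assms by simp
      with elim obtain g where xdd: "(xd has_vector_derivative xdd \<tau>) (at \<tau>)"
        and g: "g \<in> convex hull ((\<lambda>i. gf i (x \<tau>)) ` {..<m})" "xdd \<tau> = - ((\<alpha> / \<tau>) *\<^sub>R xd \<tau>) - g"
        by auto
      have "((\<lambda>\<tau>. inner (x \<tau> - z) (xd \<tau>)) has_derivative
          (\<lambda>h. inner (x \<tau> - z) (h *\<^sub>R xdd \<tau>) + inner (h *\<^sub>R xd \<tau>) (xd \<tau>))) (at \<tau>)"
        using xdd[unfolded has_vector_derivative_def] x_deriv_at[OF \<tau>0, unfolded has_vector_derivative_def]
        by (auto intro!: derivative_eq_intros)
      then have "((\<lambda>\<tau>. inner (x \<tau> - z) (xd \<tau>)) has_real_derivative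
          inner (x \<tau> - z) (xdd \<tau>) + (norm (xd \<tau>))\<^sup>2) (at \<tau>)"
        unfolding has_field_derivative_def
        by (rule has_derivative_eq_rhs) (auto simp: fun_eq_iff power2_norm_eq_inner algebra_simps)
      note this[derivative_intros] anchor_deriv[OF x_deriv_at[OF \<tau>0], derivative_intros]
        continuous_imp_integral_has_real_derivative[OF drift_cont \<tau>0, derivative_intros]
      let ?D = "\<tau> * (inner (x \<tau> - z) (xdd \<tau>) + (norm (xd \<tau>))\<^sup>2) + inner (x \<tau> - z) (xd \<tau>)
          + (\<alpha> - 1) * inner (x \<tau> - z) (xd \<tau>) - (\<tau> * (norm (xd \<tau>))\<^sup>2 - \<tau> * gap z \<tau>)"
      have "((\<lambda>t. euler_anchor z t - ?B t) has_real_derivative ?D) (at \<tau>)"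
        unfolding euler_anchor_def by (auto intro!: derivative_eq_intros)
      \<comment> \<open>The coefficients \<open>1\<close> and \<open>\<alpha> - 1\<close> of
        \<open>inner (x \<tau> - z) (xd \<tau>)\<close> add up to \<open>\<alpha>\<close> and cancel
        the friction part of \<open>\<tau> * xdd \<tau>\<close>.\<close>
      moreover have "?D = \<tau> * (gap z \<tau> - inner g (x \<tau> - z))"
        using \<tau>0 t0 unfolding g(2) inner_commute[of g] by (simp add: inner_diff_right field_simps)
      then have "?D \<le> 0"
        using gap_le_inner_hull[OF g(1), of z] \<tau>0 t0 by (simp add: mult_nonneg_nonpos)
      ultimately show "\<exists>D\<le>0. ((\<lambda>t. euler_anchor z t - ?B t) has_real_derivative D) (at \<tau>)" by blast
    qed
  qed
qed

section \<open>Dissipation and the Lyapunov function\<close>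

lemma dissipation_cont: "continuous_on {t0..} (\<lambda>s. s * (norm (xd s))\<^sup>2)"
  by (intro continuous_intros xd_cont)

lemma dissipation_deriv:
  "t0 < t \<Longrightarrow> (dissipation has_real_derivative t * (norm (xd t))\<^sup>2) (at t)"
  unfolding dissipation_def by (rule continuous_imp_integral_has_real_derivative[OF dissipation_cont])

lemma dissipation_mono:
  assumes "t0 \<le> s" "s \<le> t"
  shows "dissipation s \<le> dissipation t"
  unfolding dissipation_def
proof (intro integral_subset_le)
  show "(\<lambda>s. s * (norm (xd s))\<^sup>2) integrable_on {t0..t}" for t
    using dissipation_cont by (intro integrable_continuous_real) (auto intro: continuous_on_subset)
  then show "(\<lambda>s. s * (norm (xd s))\<^sup>2) integrable_on {t0..t}" .
qed (use assms t0 in auto)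

lemma dissipation_nonneg: "t0 \<le> t \<Longrightarrow> 0 \<le> dissipation t"
  using dissipation_mono[of t0 t] by (simp add: dissipation_def)

text \<open>This is the familiar function
  \<open>t\<^sup>2 gap + 1/2 \<parallel>2(x - z) + t x'\<parallel>\<^sup>2 + (\<alpha> - 3) \<parallel>x - z\<parallel>\<^sup>2\<close>, regrouped as
  \<open>t\<^sup>2\<close> times a nonincreasing function plus twice the Euler operator applied to the anchor.\<close>

definition lyapunov :: "'a \<Rightarrow> real \<Rightarrow> real" where
  "lyapunov z t = t\<^sup>2 * (gap z t + (norm (xd t))\<^sup>2 / 2) + 2 * euler_anchor z t"

text \<open>The minimum in \<open>gap\<close> need not be differentiable, so \<open>lyapunov\<close>
  is not differentiated. It is split into \<open>t^2\<close> times the nonincreasing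
  \<open>w\<close>, a differentiable remainder \<open>K\<close>, and twice the nonincreasing
  \<open>euler_anchor z t - B t\<close>.\<close>

lemma lyapunov_decrease:
  assumes "t0 \<le> s" "s \<le> t"
  shows "lyapunov z t + (\<alpha> - 3) * dissipation t \<le> lyapunov z s + (\<alpha> - 3) * dissipation s"
proof -
  define A where "A t = integral {t0..t} (\<lambda>s. \<alpha> / s * (norm (xd s))\<^sup>2)" for t
  define B where "B t = integral {t0..t} (\<lambda>s. s * (norm (xd s))\<^sup>2 - s * gap z s)" for t
  define w where "w t = gap z t + (norm (xd t))\<^sup>2 / 2 + A t" for t
  define K where "K t = - t\<^sup>2 * A t + 2 * B t + (\<alpha> - 3) * dissipation t" for t
  have w_anti: "w v \<le> w u" if uv: "t0 \<le> u" "u \<le> v" for u v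
  proof -
    \<comment> \<open>An index attaining the minimum at the earlier time bounds \<open>gap\<close>
      from above at the later one.\<close>
    obtain i where i: "i < m" "gap z u = f i (x u) - f i z" using gap_attained by blast
    then show ?thesis
      using gap_le[OF i(1), of z v] energy_decrease[OF i(1) uv] by (simp add: w_def A_def energy_def)
  qed
  \<comment> \<open>The factor \<open>\<alpha> - 3\<close> is the one for which the kinetic terms
    combine to exactly \<open>- 2 * \<tau> * w \<tau>\<close>.\<close>
  have K_deriv: "(K has_real_derivative - 2 * \<tau> * w \<tau>) (at \<tau>)" if "\<tau> > t0" for \<tau>
  proof -
    have [derivative_intros]: "(A has_real_derivative \<alpha> / \<tau> * (norm (xd \<tau>))\<^sup>2) (at \<tau>)"
      "(B has_real_derivative \<tau> * (norm (xd \<tau>))\<^sup>2 - \<tau> * gap z \<tau>) (at \<tau>)"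
      unfolding A_def B_def
      by (intro continuous_imp_integral_has_real_derivative friction_cont drift_cont that)+
    note dissipation_deriv[OF that, derivative_intros]
    show ?thesis
      unfolding K_def[abs_def]
      by (rule derivative_eq_intros refl)+ (use that t0 in \<open>simp add: w_def power2_eq_square field_simps\<close>)
  qed
  have "continuous_on {s..t} K"
    unfolding K_def A_def B_def dissipation_def
    by (intro continuous_intros continuous_imp_continuous_on_integral friction_cont drift_cont dissipation_cont assms)
  \<comment> \<open>Freezing \<open>w\<close> at the final time replaces the product rule: the
    derivative \<open>2 * \<tau> * (w t - w \<tau>)\<close> is nonpositive by monotonicity.\<close>
  then have "K t + t\<^sup>2 * w t \<le> K s + s\<^sup>2 * w t"
  proof (intro DERIV_nonpos_imp_decreasing_open[OF assms(2), of "\<lambda>\<tau>. K \<tau> + \<tau>\<^sup>2 * w t"])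
    fix \<tau> assume \<tau>: "s < \<tau>" "\<tau> < t"
    then have "\<tau> > t0" using assms by simp
    then have "((\<lambda>\<tau>. K \<tau> + \<tau>\<^sup>2 * w t) has_real_derivative 2 * \<tau> * (w t - w \<tau>)) (at \<tau>)"
      by (auto intro!: derivative_eq_intros K_deriv simp: algebra_simps)
    moreover have "2 * \<tau> * (w t - w \<tau>) \<le> 0"
      using w_anti[of \<tau> t] \<tau> \<open>\<tau> > t0\<close> t0 by (simp add: mult_nonneg_nonpos)
    ultimately show "\<exists>y. ((\<lambda>\<tau>. K \<tau> + \<tau>\<^sup>2 * w t) has_real_derivative y) (at \<tau>) \<and> y \<le> 0" by blast
  qed (auto intro!: continuous_intros)
  also have "s\<^sup>2 * w t \<le> s\<^sup>2 * w s" using w_anti assms by (intro mult_left_mono) auto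
  finally have "K t + t\<^sup>2 * w t \<le> K s + s\<^sup>2 * w s" by simp
  moreover have "euler_anchor z t - B t \<le> euler_anchor z s - B s"
    unfolding B_def using euler_anchor_decrease[OF assms] .
  ultimately show ?thesis by (simp add: lyapunov_def K_def w_def algebra_simps)
qed

text \<open>Completing the square writes \<open>lyapunov z t\<close> as \<open>t^2 * gap z t\<close>
  plus nonnegative terms. Every \<open>z\<close> is allowed, which lets the Pareto argument use an
  arbitrary competitor.\<close>

lemma gap_rate:
  assumes "t0 \<le> t"
  shows "t\<^sup>2 * gap z t \<le> lyapunov z t0"
proof -
  have "(norm (2 *\<^sub>R (x t - z) + t *\<^sub>R xd t))\<^sup>2
      = 4 * (norm (x t - z))\<^sup>2 + 4 * (t * inner (x t - z) (xd t)) + t\<^sup>2 * (norm (xd t))\<^sup>2"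
    unfolding power2_norm_eq_inner
    by (simp add: inner_add_left inner_add_right inner_commute power2_eq_square algebra_simps)
  then have "lyapunov z t = t\<^sup>2 * gap z t + (norm (2 *\<^sub>R (x t - z) + t *\<^sub>R xd t))\<^sup>2 / 2
      + (\<alpha> - 3) * (norm (x t - z))\<^sup>2"
    by (simp add: lyapunov_def euler_anchor_def anchor_def field_simps)
  moreover have "0 \<le> (\<alpha> - 3) * (norm (x t - z))\<^sup>2" "0 \<le> (\<alpha> - 3) * dissipation t"
    using alpha dissipation_nonneg[OF assms] by auto
  moreover have "lyapunov z t + (\<alpha> - 3) * dissipation t \<le> lyapunov z t0"
    using lyapunov_decrease[of t0 t z] assms by (simp add: dissipation_def)
  ultimately show ?thesis by (smt (verit) zero_le_power2 divide_nonneg_pos)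
qed

section \<open>Convergence of the distance to points below all energies\<close>

text \<open>The set for Opial's lemma: large enough to contain all weak cluster points, small enough
  that \<open>gap\<close> plus the kinetic energy stays nonnegative, although \<open>gap\<close>
  alone may be negative.\<close>

definition limit_set :: "'a set" where
  "limit_set = {z. \<forall>i<m. \<forall>t\<ge>t0. f i z \<le> energy i t}"

lemma gap_ge:
  assumes "z \<in> limit_set" "t0 \<le> t"
  shows "0 \<le> gap z t + (norm (xd t))\<^sup>2 / 2"
proof -
  obtain i where "i < m" "gap z t = f i (x t) - f i z" using gap_attained by blast
  moreover have "f i z \<le> energy i t" using assms \<open>i < m\<close> unfolding limit_set_def by blast
  ultimately show ?thesis by (simp add: energy_def)
qed

lemma anchor_nonneg: "0 \<le> anchor z t"
  by (simp add: anchor_def)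

text \<open>Dropping the nonnegative term \<open>(\<alpha> - 1) * anchor z t\<close> leaves
  \<open>t\<close> times the derivative of the anchor below \<open>- c\<close>, and the anchor would
  decrease logarithmically without bound.\<close>

lemma euler_anchor_not_eventually_negative:
  assumes "t0 < s" "c > 0" "\<And>t. s \<le> t \<Longrightarrow> euler_anchor z t \<le> - c"
  shows False
proof (rule logarithmic_decrease_contradiction[of s c "anchor z" "\<lambda>t. inner (x t - z) (xd t)"])
  fix t assume "s \<le> t"
  then show "(anchor z has_real_derivative inner (x t - z) (xd t)) (at t)"
    using assms by (intro anchor_deriv x_deriv_at) simp
  have "0 \<le> (\<alpha> - 1) * anchor z t" using anchor_nonneg alpha by simp
  then show "t * inner (x t - z) (xd t) \<le> - c"
    using assms(3)[OF \<open>s \<le> t\<close>] by (simp add: euler_anchor_def)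
qed (use assms t0 anchor_nonneg in auto)

text \<open>If the dissipation exceeded this bound at some time, the Lyapunov inequality would bound
  \<open>t \<cdot> (d/dt) anchor\<close> by a negative constant from then on, driving the anchor to \<open>-\<infinity>\<close> logarithmically.\<close>

lemma dissipation_bounded:
  assumes "z \<in> limit_set" "t0 < s"
  shows "(\<alpha> - 3) * dissipation s \<le> lyapunov z t0"
proof (rule ccontr)
  assume neg: "\<not> ?thesis"
  have "euler_anchor z t \<le> - (((\<alpha> - 3) * dissipation s - lyapunov z t0) / 2)" if "s \<le> t" for t
  proof -
    have "0 \<le> t\<^sup>2 * (gap z t + (norm (xd t))\<^sup>2 / 2)"
      using gap_ge[OF assms(1), of t] that assms by (intro mult_nonneg_nonneg) auto
    moreover have "lyapunov z t + (\<alpha> - 3) * dissipation t \<le> lyapunov z t0"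
      using lyapunov_decrease[of t0 t z] that assms by (simp add: dissipation_def)
    moreover have "(\<alpha> - 3) * dissipation s \<le> (\<alpha> - 3) * dissipation t"
      using dissipation_mono[of s t] that assms alpha by (intro mult_left_mono) auto
    ultimately have "2 * euler_anchor z t \<le> lyapunov z t0 - (\<alpha> - 3) * dissipation s"
      unfolding lyapunov_def[of z t] by linarith
    then show ?thesis by (simp add: field_simps)
  qed
  then show False
    using neg assms by (intro euler_anchor_not_eventually_negative[of s "((\<alpha> - 3) * dissipation s - lyapunov z t0) / 2" z]) auto
qed

lemma norm_diff_convergent:
  assumes z: "z \<in> limit_set"
  shows "\<exists>l. ((\<lambda>t. (norm (x t - z))\<^sup>2) \<longlongrightarrow> l) at_top"
proof -
  define J where "J = lyapunov z t0 / (\<alpha> - 3)"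
  have diss: "dissipation s \<le> J" if "t0 < s" for s
    using dissipation_bounded[OF z that] alpha by (simp add: J_def field_simps)
  \<comment> \<open>The factor 3/2 comes from writing
    \<open>t * (norm (xd t))^2 - t * gap z t\<close> as 3/2 of the dissipation rate minus
    \<open>t * (gap z t + (norm (xd t))^2 / 2)\<close>, whose bracket is nonnegative on
    \<open>limit_set\<close>.\<close>
  define r where "r t = euler_anchor z t - 3/2 * dissipation t" for t
  have r_anti: "r t \<le> r s" if st: "t0 \<le> s" "s \<le> t" for s t
  proof -
    define B where "B t = integral {t0..t} (\<lambda>s. s * (norm (xd s))\<^sup>2 - s * gap z s)" for t
    have "B t - 3/2 * dissipation t \<le> B s - 3/2 * dissipation s"
    proof (rule DERIV_nonpos_imp_decreasing_open[OF st(2), of "\<lambda>t. B t - 3/2 * dissipation t"])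
      show "continuous_on {s..t} (\<lambda>t. B t - 3/2 * dissipation t)"
        unfolding B_def dissipation_def
        by (intro continuous_intros continuous_imp_continuous_on_integral drift_cont dissipation_cont st)
      fix \<tau> assume \<tau>: "s < \<tau>" "\<tau> < t"
      then have \<tau>0: "\<tau> > t0" using st by simp
      note [derivative_intros] = continuous_imp_integral_has_real_derivative[OF drift_cont[of z] \<tau>0]
        continuous_imp_integral_has_real_derivative[OF dissipation_cont \<tau>0]
      have "((\<lambda>t. B t - 3/2 * dissipation t) has_real_derivative
          - \<tau> * (gap z \<tau> + (norm (xd \<tau>))\<^sup>2 / 2)) (at \<tau>)"
        unfolding B_def dissipation_def by (auto intro!: derivative_eq_intros simp: field_simps)
      moreover have "0 \<le> \<tau> * (gap z \<tau> + (norm (xd \<tau>))\<^sup>2 / 2)"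
        using gap_ge[OF z, of \<tau>] \<tau>0 t0 by (intro mult_nonneg_nonneg) auto
      ultimately show "\<exists>y. ((\<lambda>t. B t - 3/2 * dissipation t) has_real_derivative y) (at \<tau>) \<and> y \<le> 0"
        by (intro exI[of _ "- \<tau> * (gap z \<tau> + (norm (xd \<tau>))\<^sup>2 / 2)"]) auto
    qed
    moreover have "euler_anchor z t - B t \<le> euler_anchor z s - B s"
      unfolding B_def using euler_anchor_decrease[OF st] .
    ultimately show ?thesis by (simp add: r_def)
  qed
  \<comment> \<open>Below this level \<open>euler_anchor\<close> would stay at most
    \<open>- 1\<close> forever, since \<open>r\<close> is nonincreasing and the dissipation is at
    most \<open>J\<close>. Starting at \<open>t0 + 1\<close> keeps all times strictly after
    \<open>t0\<close>.\<close>
  have r_below: "- (3/2 * J) - 1 \<le> r t" if "t0 + 1 \<le> t" for t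
  proof (rule ccontr)
    assume neg: "\<not> ?thesis"
    have "euler_anchor z \<tau> \<le> - 1" if "t \<le> \<tau>" for \<tau>
      using r_anti[of t \<tau>] neg diss[of \<tau>] that \<open>t0 + 1 \<le> t\<close> by (simp add: r_def)
    then show False using euler_anchor_not_eventually_negative[of t 1 z] that by auto
  qed
  obtain l1 where l1: "(r \<longlongrightarrow> l1) at_top"
    using antimono_bounded_imp_tendsto_at_top[of "t0 + 1" r, OF r_anti r_below] by auto
  obtain l2 where l2: "((\<lambda>t. - dissipation t) \<longlongrightarrow> l2) at_top"
    using antimono_bounded_imp_tendsto_at_top[of "t0 + 1" "\<lambda>t. - dissipation t" "- J"]
      dissipation_mono diss by auto
  have "((\<lambda>t. r t - 3/2 * - dissipation t) \<longlongrightarrow> l1 - 3/2 * l2) at_top"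
    by (intro tendsto_intros l1 l2)
  then have "((\<lambda>t. t * inner (x t - z) (xd t) + (\<alpha> - 1) * anchor z t) \<longlongrightarrow> l1 - 3/2 * l2) at_top"
    by (simp add: r_def euler_anchor_def)
  then have "(anchor z \<longlongrightarrow> (l1 - 3/2 * l2) / (\<alpha> - 1)) at_top"
    using alpha by (intro tendsto_of_euler_operator[of _ t0 _ "\<lambda>t. inner (x t - z) (xd t)"] anchor_deriv x_deriv_at) auto
  then have "((\<lambda>t. 2 * anchor z t) \<longlongrightarrow> 2 * ((l1 - 3/2 * l2) / (\<alpha> - 1))) at_top"
    by (intro tendsto_intros)
  then show ?thesis by (auto simp: anchor_def)
qed

section \<open>Weak cluster points and the conclusion\<close>

text \<open>The tangent minorant of \<open>f i\<close> at \<open>z\<close>, evaluated along the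
  trajectory, is weakly continuous; together with convexity it plays the role of weak lower
  semicontinuity.\<close>

lemma weak_cluster_lower:
  assumes "i < m" "\<And>v. ((\<lambda>t. inner (x t) v) \<longlongrightarrow> inner z v) G"
  shows "((\<lambda>t. f i z + inner (gf i z) (x t - z)) \<longlongrightarrow> f i z) G"
proof -
  have "((\<lambda>t. f i z + (inner (x t) (gf i z) - inner z (gf i z))) \<longlongrightarrow>
      f i z + (inner z (gf i z) - inner z (gf i z))) G"
    by (intro tendsto_intros assms)
  then show ?thesis by (simp add: inner_diff_right inner_commute)
qed

text \<open>For \<open>t \<ge> s\<close> the tangent minorant is below \<open>f i (x t)\<close>,
  hence below \<open>energy i t\<close> and \<open>energy i s\<close>; the limit along
  \<open>G\<close> gives the bound.\<close>

lemma weak_cluster_in_limit_set: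
  assumes "G \<le> at_top" "G \<noteq> bot" "\<And>v. ((\<lambda>t. inner (x t) v) \<longlongrightarrow> inner z v) G"
  shows "z \<in> limit_set"
  unfolding limit_set_def
proof (intro CollectI allI impI)
  fix i s assume i: "i < m" and s: "t0 \<le> s"
  have "\<forall>\<^sub>F t in G. s \<le> t" by (rule filter_leD[OF assms(1) eventually_ge_at_top])
  then have "\<forall>\<^sub>F t in G. f i z + inner (gf i z) (x t - z) \<le> energy i s"
  proof eventually_elim
    case (elim t)
    have "f i z + inner (gf i z) (x t - z) \<le> energy i t"
      using convex_on_above_tangent_inner[OF f_convex grad, OF i i, of z "x t"]
      by (simp add: energy_def add_increasing2)
    also have "\<dots> \<le> energy i s" using energy_antimono[OF i s elim] .
    finally show ?case .
  qed
  then show "f i z \<le> energy i s"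
    using tendsto_upperbound[OF weak_cluster_lower[OF i assms(3)]] assms(2) by blast
qed

text \<open>If \<open>y\<close> improved all objectives, \<open>gap y t\<close> would eventually
  exceed a fixed positive margin along \<open>G\<close>, against the decay of order
  \<open>1 / t^2\<close> from \<open>gap_rate\<close>.\<close>

lemma weak_cluster_weakly_pareto:
  assumes "G \<le> at_top" "G \<noteq> bot" "\<And>v. ((\<lambda>t. inner (x t) v) \<longlongrightarrow> inner z v) G"
  shows "weakly_pareto m f z"
  unfolding weakly_pareto_def
proof
  assume "\<exists>y. \<forall>i<m. f i y < f i z"
  then obtain y where y: "\<And>i. i < m \<Longrightarrow> f i y < f i z" by blast
  \<comment> \<open>Halving the smallest improvement leaves room for the tangent values, which only
    converge to \<open>f i z\<close>.\<close>
  define e where "e = Min ((\<lambda>i. f i z - f i y) ` {..<m}) / 2"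
  have "{..<m} \<noteq> {}" using m_pos by auto
  then have "e > 0" using y by (simp add: e_def Min_gr_iff)
  have e: "f i y + e < f i z" if "i < m" for i
  proof -
    have "2 * e \<le> f i z - f i y" using that by (auto simp: e_def)
    then show ?thesis using \<open>e > 0\<close> by simp
  qed
  have "\<forall>\<^sub>F t in G. \<forall>i\<in>{..<m}. f i y + e < f i z + inner (gf i z) (x t - z)"
    using order_tendstoD(1)[OF weak_cluster_lower[OF _ assms(3)]] e
    by (intro eventually_ball_finite) auto
  moreover have "\<forall>\<^sub>F t in at_top. t\<^sup>2 > lyapunov y t0 / e"
    using filterlim_pow_at_top[OF _ filterlim_ident, of 2] unfolding filterlim_at_top_dense by simp
  then have "\<forall>\<^sub>F t in G. t\<^sup>2 > lyapunov y t0 / e" by (rule filter_leD[OF assms(1)])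
  moreover have "\<forall>\<^sub>F t in G. t0 \<le> t" by (rule filter_leD[OF assms(1) eventually_ge_at_top])
  ultimately have "\<forall>\<^sub>F t in G. False"
  proof eventually_elim
    case (elim t)
    obtain i where i: "i < m" "gap y t = f i (x t) - f i y" using gap_attained by blast
    then have "e \<le> gap y t"
      using elim(1) convex_on_above_tangent_inner[OF f_convex grad, OF i(1) i(1), of z "x t"] by force
    then have "t\<^sup>2 * e \<le> t\<^sup>2 * gap y t" by (intro mult_left_mono) auto
    also have "\<dots> \<le> lyapunov y t0" using gap_rate elim(3) by blast
    finally show False using elim(2) \<open>e > 0\<close> by (simp add: field_simps)
  qed
  then show False using assms(2) by simp
qed

theorem weak_convergence:
  assumes "bounded (x ` {t0..})"
  shows "\<exists>z. weakly_pareto m f z \<and> weakly_tendsto_at_top x z"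
proof -
  obtain M where M: "\<forall>y\<in>x ` {t0..}. norm y \<le> M" using assms unfolding bounded_iff ..
  have "\<forall>\<^sub>F t in at_top. norm (x t) \<le> M"
    using eventually_ge_at_top[of t0] by eventually_elim (use M in simp)
  then have "\<exists>z\<in>limit_set. weakly_tendsto_at_top x z"
    using norm_diff_convergent weak_cluster_in_limit_set by (rule Opial)
  then obtain z where "weakly_tendsto_at_top x z" by blast
  \<comment> \<open>The weak limit is itself a cluster point, along the filter
    \<open>at_top\<close>.\<close>
  moreover from this have "weakly_pareto m f z"
    by (intro weak_cluster_weakly_pareto[of at_top]) (auto simp: weakly_tendsto_at_top_def)
  ultimately show ?thesis by blast
qed

end

theorem theorem4p18:
  fixes m :: nat
    and f :: "nat \<Rightarrow> 'a::{real_inner, complete_space} \<Rightarrow> real"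
    and gf :: "nat \<Rightarrow> 'a \<Rightarrow> 'a"
    and \<alpha> t0 :: real and x0 :: 'a
    and x xd xdd :: "real \<Rightarrow> 'a"
  assumes m_pos: "m > 0"
    and f_convex: "\<And>i. i < m \<Longrightarrow> convex_on UNIV (f i)"
    and grad: "\<And>i z. i < m \<Longrightarrow> (f i has_derivative (\<lambda>h. inner (gf i z) h)) (at z)"
    and grad_cont: "\<And>i. i < m \<Longrightarrow> continuous_on UNIV (gf i)"
    and f_bdd: "\<And>i. i < m \<Longrightarrow> bdd_below (range (f i))"
    and alpha: "\<alpha> > 3" and t0: "t0 > 0"
    (* x is C^1 on [t0,+\<infinity>) with derivative xd *)
    and x_deriv: "\<And>t. t \<ge> t0 \<Longrightarrow> (x has_vector_derivative xd t) (at t within {t0..})"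
    and xd_cont: "continuous_on {t0..} xd"
    (* xd absolutely continuous on every [t0,T], with a.e. derivative xdd and integral representation *)
    and xd_ac: "\<And>T. T \<ge> t0 \<Longrightarrow> abs_continuous_on {t0..T} xd"
    and xdd_integral: "\<And>t. t \<ge> t0 \<Longrightarrow> (xdd has_integral (xd t - xd t0)) {t0..t}"
    and xdd_deriv: "AE t in lborel. t > t0 \<longrightarrow> (xd has_vector_derivative xdd t) (at t)"
    (* the differential equation, almost everywhere *)
    and ode: "AE t in lborel. t > t0 \<longrightarrow>
       (\<alpha> / t) *\<^sub>R xd t
       + proj ((\<lambda>c. c + xdd t) ` (convex hull ((\<lambda>i. gf i (x t)) ` {..<m}))) 0 = 0"
    and init: "x t0 = x0" "xd t0 = 0"
    and bounded: "bounded (x ` {t0..})"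
    (* Assumption on the weak Pareto set *)
    and A1: "\<And>y0 y. y \<in> level m f (\<lambda>i. f i y0) \<Longrightarrow>
               \<exists>xs. xs \<in> pareto_level m f (\<lambda>i. f i y)"
    and A2: "bdd_above ((\<lambda>p. INF z \<in> {z. \<forall>i<m. f i z = f i p}. (norm (z - x0))\<^sup>2 / 2)
                          ` pareto_level m f (\<lambda>i. f i x0))"
  shows "\<exists>xs. weakly_pareto m f xs \<and> weakly_tendsto_at_top x xs"
proof -
  interpret multiobjective_inertial_flow m f gf \<alpha> t0 x xd xdd
    using m_pos f_convex grad grad_cont alpha t0 x_deriv xd_cont xd_ac xdd_deriv ode
    by (rule multiobjective_inertial_flow.intro)
  show ?thesis using bounded by (rule weak_convergence)
qed

end
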